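(* Consider the linearized swing dynamics $\bm M\dot{\bm\omega}+\bm D\bm\omega=\delta\bm P(t)-\mathbb{L}\,\delta\bm\theta$, $\bm\omega=\delta\dot{\bm\theta}$, $t\ge0$, with $\delta\bm\theta(0)=\bm\omega(0)=0$ and constant damping-to-inertia ratio $d_i/m_i=\gamma>0$ for all $i$. Let the disturbance $\delta\bm P(t)$ be a noise acting on a set $N_n\subseteq\{1,\dots,n\}$ of network nodes (so $\delta P_i\equiv0$ for $i\notin N_n$), Gaussian, with vanishing first moments $\overline{\delta P_i(t)}=0$ and second moments $$\overline{\delta P_i(t)\,\delta P_j(t')}=\delta_{ij}\,\delta P_{0i}^2\,\exp\!\big[-|t-t'|/\tau_0\big],\qquad i,j\in N_n,$$ with noise correlation time $\tau_0>0$. Then the primary control effort performance metric averaged over the noise ensemble, $\overline{\mathcal{P}^\infty}=\lim_{T\to\infty}\overline{\mathcal{P}(T)}$, is $$\overline{\mathcal{P}^\infty}=\sum_{\alpha\ge2}\frac{\sum_{i\in N_n}\delta P_{0i}^2\,(u_{\alpha,i}^D)^2\,d_i^{-1}}{\lambda_\alpha^D\tau_0+1+\gamma^{-1}\tau_0^{-1}} .$$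
   Context: Setting: a power network with nodes $i=1,\dots,n$, symmetric line susceptances $b_{ij}=b_{ji}\ge0$, inertia $m_i>0$, damping $d_i>0$, $\bm M=\mathrm{diag}\{m_i\}$, $\bm D=\mathrm{diag}\{d_i\}$. $\bm\theta^{(0)}$ is a stable synchronous stationary solution of $m_i\dot\omega_i+d_i\omega_i=P_i-\sum_j b_{ij}\sin(\theta_i-\theta_j)$, $\omega_i=\dot\theta_i$. The weighted Laplacian $\mathbb{L}$ has entries $\mathbb{L}_{ij}=-b_{ij}\cos(\theta_i^{(0)}-\theta_j^{(0)})$ for $i\neq j$ and $\mathbb{L}_{ii}=\sum_k b_{ik}\cos(\theta_i^{(0)}-\theta_k^{(0)})$ (sum over $k\neq i$). Since the synchronous state is stable, $\mathbb{L}$ is assumed symmetric positive semidefinite with a simple zero eigenvalue, with eigenvector $(1,\dots,1)/\sqrt n$. Set $\mathbb{L}^D=\bm D^{-1/2}\mathbb{L}\bm D^{-1/2}$, with orthonormal real eigenvectors $\bm u_1^D,\dots,\bm u_n^D$ (components $u_{\alpha,i}^D$) and eigenvalues $\lambda_1^D=0$, $\lambda_\alpha^D>0$ for $\alpha\ge2$; here $\bm u_1^D=(\sqrt{d_1},\dots,\sqrt{d_n})/\sqrt{\sum_i d_i}$. The performance metric (primary control effort) is $$\mathcal{P}(T)=T^{-1}\int_0^T(\bm\omega^\top-\overline{\bm\omega}^\top)\,\bm D\,(\bm\omega-\overline{\bm\omega})\,\mathrm{d}t,$$ where $\overline{\bm\omega}^\top=(\dot\Delta,\dots,\dot\Delta)$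 with $\dot\Delta(t)=\sum_i d_i\omega_i(t)/\sum_i d_i$ (here the bar on $\bm\omega$ denotes this network average). An overline on any other quantity denotes the statistical average (expectation) over the noise ensemble. *)

theory Defs
  imports "HOL-Probability.Probability"
begin

definition diag_matrix :: "real^'n \<Rightarrow> real^'n^'n" where
  "diag_matrix v = (\<chi> i j. if i = j then v $ i else 0)"

definition pos_semidef :: "real^'n^'n \<Rightarrow> bool" where
  "pos_semidef A \<longleftrightarrow> transpose A = A \<and> (\<forall>x. 0 \<le> x \<bullet> (A *v x))"

text \<open>The nonlinear swing equations; \<open>P\<close> is the vector of power injections (in the frame
  co-rotating with the synchronous frequency).\<close>

definition swing_solution ::
  "('n::finite \<Rightarrow> 'n \<Rightarrow> real) \<Rightarrow> real^'n \<Rightarrow> real^'n \<Rightarrow> real^'n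
    \<Rightarrow> (real \<Rightarrow> real^'n) \<Rightarrow> (real \<Rightarrow> real^'n) \<Rightarrow> bool" where
  "swing_solution b m d P \<theta> \<omega> \<longleftrightarrow>
    (\<forall>t. (\<theta> has_vector_derivative \<omega> t) (at t)) \<and>
    (\<forall>t. \<exists>a. (\<omega> has_vector_derivative a) (at t) \<and>
      (\<forall>i. m $ i * a $ i + d $ i * \<omega> t $ i
           = P $ i - (\<Sum>j\<in>UNIV. b i j * sin (\<theta> t $ i - \<theta> t $ j))))"

definition weighted_laplacian ::
  "('n::finite \<Rightarrow> 'n \<Rightarrow> real) \<Rightarrow> real^'n \<Rightarrow> real^'n^'n" where
  "weighted_laplacian b \<theta>0 =
    (\<chi> i j. if i = j then (\<Sum>k\<in>UNIV - {i}. b i k * cos (\<theta>0 $ i - \<theta>0 $ k))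
            else - b i j * cos (\<theta>0 $ i - \<theta>0 $ j))"

definition damped_laplacian :: "real^'n \<Rightarrow> real^'n^'n \<Rightarrow> real^'n^'n" where
  "damped_laplacian d L =
    diag_matrix (\<chi> i. 1 / sqrt (d $ i)) ** L ** diag_matrix (\<chi> i. 1 / sqrt (d $ i))"

text \<open>One realization of the linearized dynamics on \<open>t \<ge> 0\<close>, started at rest; derivatives at
  \<open>0\<close> are one-sided.\<close>

definition linear_swing_solution ::
  "real^'n \<Rightarrow> real^'n \<Rightarrow> real^'n^'n
    \<Rightarrow> (real \<Rightarrow> real^'n) \<Rightarrow> (real \<Rightarrow> real^'n) \<Rightarrow> (real \<Rightarrow> real^'n) \<Rightarrow> bool" where
  "linear_swing_solution m d L \<delta>P \<delta>\<theta> \<omega> \<longleftrightarrow>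
    \<delta>\<theta> 0 = 0 \<and> \<omega> 0 = 0 \<and>
    (\<forall>t\<ge>0. (\<delta>\<theta> has_vector_derivative \<omega> t) (at t within {0..})) \<and>
    (\<forall>t\<ge>0. \<exists>a. (\<omega> has_vector_derivative a) (at t within {0..}) \<and>
      diag_matrix m *v a + diag_matrix d *v \<omega> t = \<delta>P t - L *v \<delta>\<theta> t)"

definition mean_frequency :: "real^'n \<Rightarrow> real^'n \<Rightarrow> real^'n" where
  "mean_frequency d w = (\<chi> i. (\<Sum>k\<in>UNIV. d $ k * w $ k) / (\<Sum>k\<in>UNIV. d $ k))"

definition control_effort :: "real^'n \<Rightarrow> (real \<Rightarrow> real^'n) \<Rightarrow> real \<Rightarrow> real" where
  "control_effort d \<omega> T =
    inverse T * integral {0..T}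
      (\<lambda>t. (\<omega> t - mean_frequency d (\<omega> t)) \<bullet>
            (diag_matrix d *v (\<omega> t - mean_frequency d (\<omega> t))))"

text \<open>Gaussian variables may be degenerate (variance \<open>0\<close>), since noise amplitudes may vanish and
  linear combinations of a Gaussian family may be constant.\<close>

definition gaussian_rv :: "'a measure \<Rightarrow> ('a \<Rightarrow> real) \<Rightarrow> bool" where
  "gaussian_rv M Y \<longleftrightarrow> Y \<in> borel_measurable M \<and>
    ((\<exists>\<mu>. AE x in M. Y x = \<mu>) \<or>
     (\<exists>\<mu> \<sigma>. 0 < \<sigma> \<and> distributed M lborel Y (normal_density \<mu> \<sigma>)))"

definition gaussian_family :: "'a measure \<Rightarrow> 'i set \<Rightarrow> ('i \<Rightarrow> 'a \<Rightarrow> real) \<Rightarrow> bool" where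
  "gaussian_family M I X \<longleftrightarrow>
    (\<forall>J c. finite J \<and> J \<subseteq> I \<longrightarrow> gaussian_rv M (\<lambda>x. \<Sum>j\<in>J. c j * X j x))"

end

(* In the coordinates u_alpha . D^(1/2) theta the constant ratio d_i / m_i decouples the network into
   scalar oscillators y' = w, w' = gamma (p - w - lam y), and by Parseval the control effort is the sum
   over alpha >= 2 of the time averages of w^2.  The balance of the energy (w^2 / gamma + lam y^2) / 2
   equates the integral of w^2 with that of w p up to a term whose expectation stays bounded (a Lyapunov
   function).  The covariances of w(s) and y(s) with p(t), s <= t, obey a linear ODE driven by
   exp (- (t - s) / tau); comparison with its equilibrium shows that E[w(t) p(t)] converges exponentially to
   c / (lam tau + 1 + 1 / (gamma tau)).  Gaussianity enters only through square integrability. *)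

theory Submission
  imports Defs
begin

text \<open>The obstacle is regularity. Along a path only the displacement and the frequency are
  known to be continuous; the forcing is whatever makes the response differentiable. Expectations
  and time integrals can be exchanged only with joint measurability, which is not given and is
  extracted from the motion itself. Increments of a path are gauge integrals of its derivative on
  every path, but they agree with Lebesgue integrals only where these converge absolutely, which
  Fubini grants on almost every path. Second moments bounded uniformly in time therefore serve
  twice: they dominate in Fubini, and they keep the expected final energy bounded. In the covariance
  argument \<open>t\<close> is frozen and \<open>s\<close> runs. Then \<open>p(t)\<close> is a
  single random variable, and multiplying the linear equations by it keeps them linear and closed.
  The covariance of the noise, unlike its paths, is continuous in time, so the averaged system is
  classically differentiable although the forcing need not be continuous.\<close>

section \<open>Deterministic estimates for a damped oscillator\<close>

lemma decreasing_if_derivative_nonpos: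
  fixes G :: "real \<Rightarrow> real"
  assumes "a \<le> b"
    and "\<And>t. t \<in> {a..b} \<Longrightarrow> (G has_real_derivative G' t) (at t within {a..b})"
    and "\<And>t. t \<in> {a..b} \<Longrightarrow> G' t \<le> 0"
  shows "G b \<le> G a"
proof -
  have "(G' has_integral (G b - G a)) {a..b}"
    using assms(1,2)
    by (intro fundamental_theorem_of_calculus)
       (auto simp: has_real_derivative_iff_has_vector_derivative)
  moreover have "((\<lambda>_. 0) has_integral (0::real)) {a..b}" by simp
  ultimately show ?thesis
    using has_integral_le[of G' "G b - G a" "{a..b}" "\<lambda>_. 0" 0] assms(3) by simp
qed

text \<open>Work minus dissipation is the derivative of the energy. The integral is a gauge
  integral, for which the fundamental theorem holds for every pointwise derivative, so the argument
  works without regularity of \<open>p\<close> in time.\<close>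

lemma oscillator_energy_balance:
  fixes y w p :: "real \<Rightarrow> real"
  assumes "0 < \<gamma>" "0 \<le> T" "y 0 = 0" "w 0 = 0"
    and dy: "\<And>t. 0 \<le> t \<Longrightarrow> (y has_real_derivative w t) (at t within {0..})"
    and dw: "\<And>t. 0 \<le> t \<Longrightarrow>
          (w has_real_derivative \<gamma> * (p t - w t - lam * y t)) (at t within {0..})"
  shows "((\<lambda>t. w t * p t - (w t)\<^sup>2) has_integral ((w T)\<^sup>2 / \<gamma> + lam * (y T)\<^sup>2) / 2) {0..T}"
proof -
  let ?E = "\<lambda>t. ((w t)\<^sup>2 / \<gamma> + lam * (y t)\<^sup>2) / 2"
  have "(?E has_real_derivative w t * p t - (w t)\<^sup>2) (at t within {0..T})" if "t \<in> {0..T}" for t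
  proof -
    have *: "(y has_real_derivative w t) (at t within {0..T})"
      "(w has_real_derivative \<gamma> * (p t - w t - lam * y t)) (at t within {0..T})"
      using that by (auto intro!: DERIV_subset[OF dy] DERIV_subset[OF dw])
    show ?thesis
      using \<open>0 < \<gamma>\<close>
      by (auto intro!: derivative_eq_intros * simp: field_simps power2_eq_square)
  qed
  then have "((\<lambda>t. w t * p t - (w t)\<^sup>2) has_integral (?E T - ?E 0)) {0..T}"
    using \<open>0 \<le> T\<close> by (intro fundamental_theorem_of_calculus)
      (auto simp: has_real_derivative_iff_has_vector_derivative)
  then show ?thesis using assms by simp
qed

text \<open>The first factor of \<open>\<kappa>\<close> is the Lyapunov function \<open>V\<close>; the bracket added to \<open>\<kappa> * V\<close> is its
  derivative along the motion.  The cross term \<open>y * w\<close> makes \<open>V\<close> decay also in \<open>y\<close>, which the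
  energy alone does not.\<close>

lemma oscillator_Lyapunov_rate:
  fixes y w p :: real
  assumes "0 < \<gamma>" "0 < lam"
  defines "\<kappa> \<equiv> \<gamma> * lam / (3 * (lam + \<gamma>))"
  shows "\<kappa> * (w\<^sup>2 / \<gamma> + lam * y\<^sup>2 + y * w + \<gamma> / 2 * y\<^sup>2)
      + (2 * w * p - w\<^sup>2 + \<gamma> * y * p - \<gamma> * lam * y\<^sup>2) \<le> (2 + \<gamma> / (2 * lam)) * p\<^sup>2"
proof -
  have k0: "0 \<le> \<kappa>" using assms by simp
  \<comment> \<open>Young's inequality spends half of each dissipation term,
    \<open>w\<^sup>2 / 2\<close> and \<open>\<gamma> * lam / 2 * y\<^sup>2\<close>, on the forcing;
    this produces the coefficient of \<open>p\<^sup>2\<close>. The other half has to pay for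
    \<open>\<kappa> * V\<close>.\<close>
  have "2 * w * p \<le> 2 * p\<^sup>2 + w\<^sup>2 / 2"
    using zero_le_power2[of "2 * p - w"] by (simp add: power2_eq_square algebra_simps)
  moreover have "\<gamma> * y * p \<le> \<gamma> * lam / 2 * y\<^sup>2 + \<gamma> / (2 * lam) * p\<^sup>2"
  proof -
    have "0 \<le> \<gamma> / (2 * lam) * (lam * y - p)\<^sup>2" using assms by simp
    also have "\<dots> = \<gamma> * lam / 2 * y\<^sup>2 + \<gamma> / (2 * lam) * p\<^sup>2 - \<gamma> * y * p"
      using assms by (simp add: power2_eq_square field_simps)
    finally show ?thesis by simp
  qed
  \<comment> \<open>Bounding \<open>y * w\<close> by squares leaves the coefficients
    \<open>3 / (2 * \<gamma>)\<close> and \<open>lam + \<gamma>\<close>; \<open>\<kappa>\<close> is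
    small enough that its products with them do not exceed \<open>1 / 2\<close> and
    \<open>\<gamma> * lam / 2\<close>.\<close>
  moreover have "\<kappa> * (w\<^sup>2 / \<gamma> + lam * y\<^sup>2 + y * w + \<gamma> / 2 * y\<^sup>2) \<le> w\<^sup>2 / 2 + \<gamma> * lam / 2 * y\<^sup>2"
  proof -
    have "0 \<le> (w - \<gamma> * y)\<^sup>2 / (2 * \<gamma>)" using assms by simp
    also have "\<dots> = w\<^sup>2 / (2 * \<gamma>) + \<gamma> / 2 * y\<^sup>2 - y * w"
      using assms by (simp add: power2_eq_square field_simps)
    finally have "w\<^sup>2 / \<gamma> + lam * y\<^sup>2 + y * w + \<gamma> / 2 * y\<^sup>2
        \<le> 3 / (2 * \<gamma>) * w\<^sup>2 + (lam + \<gamma>) * y\<^sup>2"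
      by (simp add: distrib_right)
    then have "\<kappa> * (w\<^sup>2 / \<gamma> + lam * y\<^sup>2 + y * w + \<gamma> / 2 * y\<^sup>2)
        \<le> \<kappa> * (3 / (2 * \<gamma>) * w\<^sup>2 + (lam + \<gamma>) * y\<^sup>2)"
      using k0 by (rule mult_left_mono)
    also have "\<dots> = lam / (lam + \<gamma>) * (w\<^sup>2 / 2) + \<gamma> * lam / 3 * y\<^sup>2"
    proof -
      have "\<kappa> * (3 / (2 * \<gamma>)) = lam / (lam + \<gamma>) / 2" "\<kappa> * (lam + \<gamma>) = \<gamma> * lam / 3"
      proof -
        obtain s where "s = lam + \<gamma>" "s > 0" using assms by simp
        then show "\<kappa> * (3 / (2 * \<gamma>)) = lam / (lam + \<gamma>) / 2" "\<kappa> * (lam + \<gamma>) = \<gamma> * lam / 3"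
          using assms by (simp_all add: \<kappa>_def flip: \<open>s = lam + \<gamma>\<close>)
      qed
      moreover have "\<kappa> * (3 / (2 * \<gamma>) * w\<^sup>2 + (lam + \<gamma>) * y\<^sup>2)
          = \<kappa> * (3 / (2 * \<gamma>)) * w\<^sup>2 + \<kappa> * (lam + \<gamma>) * y\<^sup>2"
        by (simp add: algebra_simps)
      ultimately show ?thesis by (simp only:)
    qed
    also have "\<dots> \<le> w\<^sup>2 / 2 + \<gamma> * lam / 2 * y\<^sup>2"
    proof (rule add_mono)
      show "lam / (lam + \<gamma>) * (w\<^sup>2 / 2) \<le> w\<^sup>2 / 2"
        using assms by (intro mult_left_le_one_le) auto
      show "\<gamma> * lam / 3 * y\<^sup>2 \<le> \<gamma> * lam / 2 * y\<^sup>2"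
        using assms by (intro mult_right_mono) auto
    qed
    finally show ?thesis .
  qed
  ultimately show ?thesis by (simp add: algebra_simps)
qed

text \<open>Gronwall's argument with a weight that equals 1 at \<open>T\<close> and decays into the
  past. The right side is a convolution with a decaying exponential, so its expectation stays
  bounded as \<open>T\<close> grows.\<close>

lemma oscillator_bound:
  fixes y w p :: "real \<Rightarrow> real"
  assumes pos: "0 < \<gamma>" "0 < lam" and "0 \<le> T" "y 0 = 0" "w 0 = 0"
    and dy: "\<And>t. 0 \<le> t \<Longrightarrow> (y has_real_derivative w t) (at t within {0..})"
    and dw: "\<And>t. 0 \<le> t \<Longrightarrow>
          (w has_real_derivative \<gamma> * (p t - w t - lam * y t)) (at t within {0..})"
  defines "\<kappa> \<equiv> \<gamma> * lam / (3 * (lam + \<gamma>))"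
  assumes int: "(\<lambda>t. exp (\<kappa> * (t - T)) * (p t)\<^sup>2) integrable_on {0..T}"
  shows "(w T)\<^sup>2 / (2 * \<gamma>) + lam * (y T)\<^sup>2
      \<le> (2 + \<gamma> / (2 * lam)) * integral {0..T} (\<lambda>t. exp (\<kappa> * (t - T)) * (p t)\<^sup>2)"
proof -
  \<comment> \<open>The last term cancels the \<open>- \<gamma> * y * w\<close> that comes from
    differentiating \<open>y * w\<close>, and the first two cancel each other's mixed terms; hence
    \<open>V'\<close> contains no product \<open>y * w\<close>.\<close>
  define V where "V t = (w t)\<^sup>2 / \<gamma> + lam * (y t)\<^sup>2 + y t * w t + \<gamma> / 2 * (y t)\<^sup>2" for t
  define V' where "V' t = 2 * w t * p t - (w t)\<^sup>2 + \<gamma> * y t * p t - \<gamma> * lam * (y t)\<^sup>2" for t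
  let ?G = "\<lambda>t. exp (\<kappa> * (t - T)) * V t"
  have der: "(?G has_real_derivative exp (\<kappa> * (t - T)) * (\<kappa> * V t + V' t)) (at t within {0..T})"
    if "t \<in> {0..T}" for t
  proof -
    have *: "(y has_real_derivative w t) (at t within {0..T})"
      "(w has_real_derivative \<gamma> * (p t - w t - lam * y t)) (at t within {0..T})"
      using that by (auto intro!: DERIV_subset[OF dy] DERIV_subset[OF dw])
    have V: "(V has_real_derivative V' t) (at t within {0..T})"
      unfolding V_def V'_def using pos
      by (auto intro!: derivative_eq_intros * simp: field_simps power2_eq_square)
    show ?thesis
      by (rule derivative_eq_intros V refl)+ (simp add: algebra_simps)
  qed
  have 1: "((\<lambda>t. exp (\<kappa> * (t - T)) * (\<kappa> * V t + V' t)) has_integral (?G T - ?G 0)) {0..T}"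
    using der \<open>0 \<le> T\<close> by (intro fundamental_theorem_of_calculus)
      (auto simp: has_real_derivative_iff_has_vector_derivative)
  have 2: "((\<lambda>t. (2 + \<gamma> / (2 * lam)) * (exp (\<kappa> * (t - T)) * (p t)\<^sup>2)) has_integral
      (2 + \<gamma> / (2 * lam)) * integral {0..T} (\<lambda>t. exp (\<kappa> * (t - T)) * (p t)\<^sup>2)) {0..T}"
    using int by (intro has_integral_mult_right integrable_integral)
  have "?G T - ?G 0
      \<le> (2 + \<gamma> / (2 * lam)) * integral {0..T} (\<lambda>t. exp (\<kappa> * (t - T)) * (p t)\<^sup>2)"
  proof (rule has_integral_le[OF 1 2])
    fix t
    have "\<kappa> * V t + V' t \<le> (2 + \<gamma> / (2 * lam)) * (p t)\<^sup>2"
      using oscillator_Lyapunov_rate[OF pos, of "w t" "y t" "p t"] by (simp add: V_def V'_def \<kappa>_def)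
    from mult_left_mono[OF this, of "exp (\<kappa> * (t - T))"]
    show "exp (\<kappa> * (t - T)) * (\<kappa> * V t + V' t)
        \<le> (2 + \<gamma> / (2 * lam)) * (exp (\<kappa> * (t - T)) * (p t)\<^sup>2)"
      by (simp add: algebra_simps)
  qed
  moreover have "?G 0 = 0" using assms by (simp add: V_def)
  \<comment> \<open>Half of \<open>w\<^sup>2 / \<gamma>\<close> and
    \<open>\<gamma> / 2 * y\<^sup>2\<close> complete the square with the cross term of
    \<open>V\<close>; the rest is the left side.\<close>
  moreover have "(w T)\<^sup>2 / (2 * \<gamma>) + lam * (y T)\<^sup>2 \<le> ?G T"
  proof -
    have "0 \<le> (w T + \<gamma> * y T)\<^sup>2 / (2 * \<gamma>)" using pos by simp
    also have "\<dots> = (w T)\<^sup>2 / (2 * \<gamma>) + \<gamma> / 2 * (y T)\<^sup>2 + y T * w T"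
      using pos by (simp add: power2_eq_square field_simps)
    finally have "0 \<le> (w T)\<^sup>2 / (2 * \<gamma>) + \<gamma> / 2 * (y T)\<^sup>2 + y T * w T" .
    moreover have "(w T)\<^sup>2 / \<gamma> = (w T)\<^sup>2 / (2 * \<gamma>) + (w T)\<^sup>2 / (2 * \<gamma>)" by simp
    ultimately show ?thesis unfolding V_def by simp
  qed
  ultimately show ?thesis by linarith
qed

text \<open>After rescaling by \<open>exp ((t - s) / \<tau>)\<close> the equations become autonomous with the equilibrium
  \<open>(\<tau> * b, b)\<close>, towards which the energy contracts at rate \<open>2 / \<tau>\<close>.\<close>

lemma cross_covariance_limit:
  fixes F \<Phi> :: "real \<Rightarrow> real"
  assumes pos: "0 < \<gamma>" "0 < lam" "0 < \<tau>" and "0 \<le> t"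
    and init: "F 0 = 0" "\<Phi> 0 = 0"
    and d\<Phi>: "\<And>s. s \<in> {0..t} \<Longrightarrow> (\<Phi> has_real_derivative F s) (at s within {0..t})"
    and dF: "\<And>s. s \<in> {0..t} \<Longrightarrow> (F has_real_derivative
          \<gamma> * (c * exp (- (t - s) / \<tau>) - F s - lam * \<Phi> s)) (at s within {0..t})"
  defines "b \<equiv> c / (lam * \<tau> + 1 + inverse \<gamma> * inverse \<tau>)"
  shows "\<bar>F t - b\<bar> \<le> \<bar>b\<bar> * sqrt (1 + \<gamma> * lam * \<tau>\<^sup>2) * exp (- t / \<tau>)"
proof -
  define f where "f s = exp ((t - s) / \<tau>) * F s - b" for s
  define \<phi> where "\<phi> s = exp ((t - s) / \<tau>) * \<Phi> s - \<tau> * b" for s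
  define G where "G s = exp (2 * s / \<tau>) * ((f s)\<^sup>2 / \<gamma> + lam * (\<phi> s)\<^sup>2)" for s
  have "0 < lam * \<tau> + 1 + inverse \<gamma> * inverse \<tau>" using pos by (simp add: add_pos_pos)
  then have b: "c = b * (lam * \<tau> + 1 + inverse \<gamma> * inverse \<tau>)" by (simp add: b_def)
  have "G t \<le> G 0"
  proof (rule decreasing_if_derivative_nonpos[OF \<open>0 \<le> t\<close>])
    fix s assume s: "s \<in> {0..t}"
    let ?e = "exp ((t - s) / \<tau>)"
    have e: "?e * exp (- (t - s) / \<tau>) = 1" by (simp flip: exp_add add: divide_simps)
    have e': "((\<lambda>s. exp ((t - s) / \<tau>)) has_real_derivative - ?e / \<tau>) (at s within {0..t})"
      using pos by (auto intro!: derivative_eq_intros)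
    have "(f has_real_derivative - ?e / \<tau> * F s + \<gamma> * (c * exp (- (t - s) / \<tau>) - F s - lam * \<Phi> s) * ?e)
        (at s within {0..t})"
      unfolding f_def using DERIV_diff[OF DERIV_mult'[OF e' dF[OF s]] DERIV_const[of b]]
      by (simp add: algebra_simps)
    moreover have "\<gamma> * (c * exp (- (t - s) / \<tau>) - F s - lam * \<Phi> s) * ?e
        = \<gamma> * c * (?e * exp (- (t - s) / \<tau>)) - \<gamma> * (?e * F s) - \<gamma> * lam * (?e * \<Phi> s)"
      by (simp add: algebra_simps)
    \<comment> \<open>The equilibrium condition of the rescaled equation for \<open>F\<close>:
      elastic force, friction and the drift \<open>1 / \<tau>\<close> caused by the rescaling
      balance the constant forcing. This is where the three summands of the denominator come
      from.\<close>
    moreover have "\<gamma> * c = \<gamma> * lam * (\<tau> * b) + \<gamma> * b + b / \<tau>"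
      using pos by (simp add: b field_simps)
    ultimately have f': "(f has_real_derivative - f s / \<tau> - \<gamma> * f s - \<gamma> * lam * \<phi> s) (at s within {0..t})"
      unfolding f_def \<phi>_def e using pos
      by (elim DERIV_cong) (simp add: algebra_simps diff_divide_distrib)
    have "(\<phi> has_real_derivative - ?e / \<tau> * \<Phi> s + F s * ?e) (at s within {0..t})"
      unfolding \<phi>_def using DERIV_diff[OF DERIV_mult'[OF e' d\<Phi>[OF s]] DERIV_const[of "\<tau> * b"]]
      by (simp add: algebra_simps)
    then have \<phi>': "(\<phi> has_real_derivative f s - \<phi> s / \<tau>) (at s within {0..t})"
      unfolding f_def \<phi>_def using pos
      by (elim DERIV_cong) (simp add: algebra_simps diff_divide_distrib)
    have "(G has_real_derivative
        exp (2 * s / \<tau>) * (2 * f s * (- f s / \<tau> - \<gamma> * f s - \<gamma> * lam * \<phi> s) / \<gamma>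
          + lam * (2 * \<phi> s * (f s - \<phi> s / \<tau>)))
        + 2 / \<tau> * exp (2 * s / \<tau>) * ((f s)\<^sup>2 / \<gamma> + lam * (\<phi> s)\<^sup>2)) (at s within {0..t})"
      unfolding G_def using pos
      by (auto intro!: derivative_eq_intros f' \<phi>' simp: mult_ac)
    \<comment> \<open>The weights \<open>1 / \<gamma>\<close> and \<open>lam\<close> make the mixed
      terms in \<open>f s * \<phi> s\<close> cancel, and the factor
      \<open>exp (2 * s / \<tau>)\<close> exactly offsets the decay \<open>1 / \<tau>\<close> of
      both coordinates. Only friction remains.\<close>
    then show "(G has_real_derivative - 2 * exp (2 * s / \<tau>) * (f s)\<^sup>2) (at s within {0..t})"
      using pos by (elim DERIV_cong) (simp add: field_simps power2_eq_square)
    show "- 2 * exp (2 * s / \<tau>) * (f s)\<^sup>2 \<le> 0" by simp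
  qed
  \<comment> \<open>Starting at rest means starting at distance \<open>b\<close> and
    \<open>\<tau> * b\<close> from the equilibrium. Multiplied by \<open>\<gamma>\<close>, this
    initial energy gives the constant under the root.\<close>
  also have "G 0 = b\<^sup>2 / \<gamma> + lam * (\<tau> * b)\<^sup>2"
    using init by (simp add: G_def f_def \<phi>_def)
  finally have "exp (2 * t / \<tau>) * ((f t)\<^sup>2 / \<gamma>) \<le> b\<^sup>2 / \<gamma> + lam * (\<tau> * b)\<^sup>2"
  proof -
    assume "G t \<le> b\<^sup>2 / \<gamma> + lam * (\<tau> * b)\<^sup>2"
    moreover have "0 \<le> exp (2 * t / \<tau>) * (lam * (\<phi> t)\<^sup>2)" using pos by simp
    ultimately show ?thesis unfolding G_def distrib_left by linarith
  qed
  then have "exp (2 * t / \<tau>) * (f t)\<^sup>2 \<le> b\<^sup>2 * (1 + \<gamma> * lam * \<tau>\<^sup>2)"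
    using pos by (simp add: field_simps power2_eq_square)
  then have "(exp (t / \<tau>) * f t)\<^sup>2 \<le> b\<^sup>2 * (1 + \<gamma> * lam * \<tau>\<^sup>2)"
    by (simp add: power_mult_distrib flip: exp_double)
  then have "sqrt ((exp (t / \<tau>) * f t)\<^sup>2) \<le> sqrt (b\<^sup>2 * (1 + \<gamma> * lam * \<tau>\<^sup>2))"
    by (rule real_sqrt_le_mono)
  then have "exp (t / \<tau>) * \<bar>f t\<bar> \<le> \<bar>b\<bar> * sqrt (1 + \<gamma> * lam * \<tau>\<^sup>2)"
    by (simp add: real_sqrt_mult abs_mult)
  then show ?thesis
    using exp_gt_zero[of "t / \<tau>"] by (simp add: f_def exp_minus divide_simps mult.commute)
qed

section \<open>Measurability and integrability of random paths\<close>

text \<open>A crude substitute for the Cauchy-Schwarz inequality: it turns uniform second moments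
  into the uniform first absolute moments that the exchange of integrals requires.\<close>

lemma integrable_mult_if_squares:
  fixes f g :: "'a \<Rightarrow> real"
  assumes [measurable]: "f \<in> borel_measurable M" "g \<in> borel_measurable M"
    and "integrable M (\<lambda>x. (f x)\<^sup>2)" "integrable M (\<lambda>x. (g x)\<^sup>2)"
  shows "integrable M (\<lambda>x. f x * g x)"
    and "(\<integral>x. \<bar>f x * g x\<bar> \<partial>M) \<le> (\<integral>x. (f x)\<^sup>2 \<partial>M) + (\<integral>x. (g x)\<^sup>2 \<partial>M)"
proof -
  have le: "\<bar>f x * g x\<bar> \<le> (f x)\<^sup>2 + (g x)\<^sup>2" for x
    using zero_le_power2[of "\<bar>f x\<bar> - \<bar>g x\<bar>"] zero_le_power2[of "f x"] zero_le_power2[of "g x"]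
    unfolding power2_diff abs_mult power2_abs by linarith
  show i: "integrable M (\<lambda>x. f x * g x)"
    by (rule Bochner_Integration.integrable_bound[of _ "\<lambda>x. (f x)\<^sup>2 + (g x)\<^sup>2"])
       (use assms le in \<open>auto intro!: AE_I2\<close>)
  have "(\<integral>x. \<bar>f x * g x\<bar> \<partial>M) \<le> (\<integral>x. (f x)\<^sup>2 + (g x)\<^sup>2 \<partial>M)"
    using assms le i by (intro integral_mono) auto
  then show "(\<integral>x. \<bar>f x * g x\<bar> \<partial>M) \<le> (\<integral>x. (f x)\<^sup>2 \<partial>M) + (\<integral>x. (g x)\<^sup>2 \<partial>M)"
    using assms by simp
qed

text \<open>A uniform bound on the first absolute moment over a bounded interval gives absolute
  integrability on the product space. Integrability in time then holds for almost every
  \<open>x\<close> only, so later pathwise identities that involve the forcing are claimed almost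
  everywhere.\<close>

lemma Fubini_bounded_expectation:
  fixes f :: "'a \<Rightarrow> real \<Rightarrow> real"
  assumes "sigma_finite_measure M"
    and f[measurable]: "(\<lambda>(x, t). f x t) \<in> borel_measurable (M \<Otimes>\<^sub>M lborel)"
    and int: "\<forall>t\<in>{a..b}. integrable M (\<lambda>x. f x t)"
    and bd: "\<forall>t\<in>{a..b}. (\<integral>x. \<bar>f x t\<bar> \<partial>M) \<le> K"
  shows "AE x in M. set_integrable lborel {a..b} (f x)"
    and "integrable M (\<lambda>x. LINT t:{a..b}|lborel. f x t)"
    and "set_integrable lborel {a..b} (\<lambda>t. \<integral>x. f x t \<partial>M)"
    and "(\<integral>x. (LINT t:{a..b}|lborel. f x t) \<partial>M) = (LINT t:{a..b}|lborel. \<integral>x. f x t \<partial>M)"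
proof -
  interpret sigma_finite_measure M by fact
  interpret P: pair_sigma_finite lborel M ..
  interpret Q: pair_sigma_finite M lborel ..
  let ?g = "\<lambda>t x. indicator {a..b} t * f x t"
  have gm[measurable]: "(\<lambda>(t, x). ?g t x) \<in> borel_measurable (lborel \<Otimes>\<^sub>M M)" by measurable
  have "integrable (lborel \<Otimes>\<^sub>M M) (\<lambda>(t, x). ?g t x)"
  proof (rule P.Fubini_integrable[OF gm])
    show "integrable lborel (\<lambda>t. \<integral>x. norm ((\<lambda>(t, x). ?g t x) (t, x)) \<partial>M)"
    proof (rule Bochner_Integration.integrable_bound[of _ "\<lambda>t. indicator {a..b} t * K"])
      show "integrable lborel (\<lambda>t. indicator {a..b} t * K)"
        by (intro integrable_mult_left integrable_real_indicator)
           (auto simp: emeasure_lborel_Icc_eq)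
      show "AE t in lborel. norm (\<integral>x. norm ((\<lambda>(t, x). ?g t x) (t, x)) \<partial>M)
          \<le> norm (indicator {a..b} t * K)"
        using bd by (auto intro!: AE_I2 simp: abs_mult indicator_def intro: order_trans[OF _ abs_ge_self])
    qed measurable
    show "AE t in lborel. integrable M (\<lambda>x. (\<lambda>(t, x). ?g t x) (t, x))"
      using int by (auto intro!: AE_I2 simp: indicator_def)
  qed
  from P.integrable_product_swap[OF this]
  have g: "integrable (M \<Otimes>\<^sub>M lborel) (\<lambda>(x, t). ?g t x)" by simp
  show "AE x in M. set_integrable lborel {a..b} (f x)"
    using Q.AE_integrable_fst[OF g] by (simp add: set_integrable_def)
  show "integrable M (\<lambda>x. LINT t:{a..b}|lborel. f x t)"
    using Q.integrable_fst[OF g] by (simp add: set_lebesgue_integral_def)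
  show "set_integrable lborel {a..b} (\<lambda>t. \<integral>x. f x t \<partial>M)"
    using Q.integrable_snd[OF g] by (simp add: set_integrable_def)
  show "(\<integral>x. (LINT t:{a..b}|lborel. f x t) \<partial>M) = (LINT t:{a..b}|lborel. \<integral>x. f x t \<partial>M)"
    using Q.Fubini_integral[OF g] by (simp add: set_lebesgue_integral_def)
qed

text \<open>Rounding time down to a grid of mesh \<open>1 / n\<close> leaves countably many
  measurable slices, and continuity of the paths recovers \<open>f\<close> in the limit. For
  \<open>n = 0\<close> the division yields the grid point 0, which the limit does not see.\<close>

lemma Caratheodory_measurable:
  fixes f :: "'a \<Rightarrow> real \<Rightarrow> real"
  assumes meas: "\<And>t. (\<lambda>x. f x t) \<in> borel_measurable M"
    and cont: "\<And>x. x \<in> space M \<Longrightarrow> continuous_on UNIV (f x)"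
  shows "(\<lambda>(x, t). f x t) \<in> borel_measurable (M \<Otimes>\<^sub>M lborel)"
proof (rule borel_measurable_LIMSEQ_real)
  let ?q = "\<lambda>n t. of_int \<lfloor>real n * t\<rfloor> / real n :: real"
  fix n
  have "(\<lambda>z. f (fst z) (of_int i / real n)) \<in> borel_measurable (M \<Otimes>\<^sub>M (lborel :: real measure))"
    for i :: int
    by (rule measurable_compose[OF measurable_fst meas])
  moreover have "(\<lambda>z. \<lfloor>real n * snd z\<rfloor>) \<in> measurable (M \<Otimes>\<^sub>M (lborel :: real measure)) (count_space UNIV)"
    by measurable
  ultimately have "(\<lambda>z. f (fst z) (of_int \<lfloor>real n * snd z\<rfloor> / real n)) \<in> borel_measurable (M \<Otimes>\<^sub>M lborel)"
    by (rule measurable_compose_countable)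
  then show "(\<lambda>z. f (fst z) (?q n (snd z))) \<in> borel_measurable (M \<Otimes>\<^sub>M lborel)" by simp
next
  fix z assume z: "z \<in> space (M \<Otimes>\<^sub>M (lborel :: real measure))"
  have "(\<lambda>n. of_int \<lfloor>real n * snd z\<rfloor> / real n) \<longlonglongrightarrow> snd z"
  proof (rule tendsto_sandwich)
    show "(\<lambda>n. snd z - 1 / real n) \<longlonglongrightarrow> snd z"
      using tendsto_diff[OF tendsto_const lim_1_over_n, of "snd z"] by simp
    show "\<forall>\<^sub>F n in sequentially. snd z - 1 / real n \<le> of_int \<lfloor>real n * snd z\<rfloor> / real n"
    proof (intro eventually_sequentiallyI[of 1])
      fix n :: nat assume "1 \<le> n"
      then have "snd z - 1 / real n = (real n * snd z - 1) / real n"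
        by (simp add: diff_divide_distrib)
      also have "\<dots> \<le> of_int \<lfloor>real n * snd z\<rfloor> / real n"
        by (intro divide_right_mono) linarith+
      finally show "snd z - 1 / real n \<le> of_int \<lfloor>real n * snd z\<rfloor> / real n" .
    qed
    show "\<forall>\<^sub>F n in sequentially. of_int \<lfloor>real n * snd z\<rfloor> / real n \<le> snd z"
    proof (intro eventually_sequentiallyI[of 1])
      fix n :: nat assume "1 \<le> n"
      then show "of_int \<lfloor>real n * snd z\<rfloor> / real n \<le> snd z"
        using of_int_floor_le[of "real n * snd z"] by (simp add: field_simps)
    qed
  qed simp
  moreover have "isCont (f (fst z)) (snd z)"
    using cont[of "fst z"] z by (simp add: space_pair_measure mem_Times_iff continuous_on_eq_continuous_at)
  ultimately show "(\<lambda>n. f (fst z) (of_int \<lfloor>real n * snd z\<rfloor> / real n)) \<longlonglongrightarrow> (\<lambda>(x, t). f x t) z"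
    using isCont_tendsto_compose by (fastforce simp: case_prod_beta)
qed

text \<open>The forcing need not be continuous in time; it is jointly measurable because the equation of
  motion makes it a limit of difference quotients.  Times are clipped by \<open>max 0\<close> since nothing is
  known before \<open>0\<close>.\<close>

lemma oscillator_measurable:
  fixes y w p :: "'a \<Rightarrow> real \<Rightarrow> real"
  assumes "0 < \<gamma>"
    and y_0: "\<And>x. x \<in> space M \<Longrightarrow> y x 0 = 0"
    and y_deriv: "\<And>x t. x \<in> space M \<Longrightarrow> 0 \<le> t \<Longrightarrow>
          (y x has_real_derivative w x t) (at t within {0..})"
    and w_deriv: "\<And>x t. x \<in> space M \<Longrightarrow> 0 \<le> t \<Longrightarrow>
          (w x has_real_derivative \<gamma> * (p x t - w x t - lam * y x t)) (at t within {0..})"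
    and w_meas: "\<And>t. 0 \<le> t \<Longrightarrow> (\<lambda>x. w x t) \<in> borel_measurable M"
  shows "(\<lambda>(x, t). y x (max 0 t)) \<in> borel_measurable (M \<Otimes>\<^sub>M lborel)"
    and "(\<lambda>(x, t). w x (max 0 t)) \<in> borel_measurable (M \<Otimes>\<^sub>M lborel)"
    and "(\<lambda>(x, t). p x (max 0 t)) \<in> borel_measurable (M \<Otimes>\<^sub>M lborel)"
proof -
  have cy: "continuous_on {0..} (y x)" and cw: "continuous_on {0..} (w x)" if "x \<in> space M" for x
    using that by (auto intro!: DERIV_continuous_on y_deriv w_deriv)
  have cm: "continuous_on UNIV (\<lambda>t. f (max 0 t))" if "continuous_on {0..} f" for f :: "real \<Rightarrow> real"
    by (rule continuous_on_compose2[OF that]) (auto intro!: continuous_intros)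
  show wm[measurable]: "(\<lambda>(x, t). w x (max 0 t)) \<in> borel_measurable (M \<Otimes>\<^sub>M lborel)"
    using w_meas cm[OF cw] by (intro Caratheodory_measurable) auto
  \<comment> \<open>Measurability of \<open>y\<close> is recovered from \<open>w\<close>: starting
    from 0, \<open>y\<close> is the time integral of a jointly measurable function, hence measurable
    in the parameter.\<close>
  have "(\<lambda>x. y x (max 0 t)) \<in> borel_measurable M" for t
  proof -
    have "(\<lambda>x. LINT s:{0..max 0 t}|lborel. w x (max 0 s)) \<in> borel_measurable M"
      unfolding set_lebesgue_integral_def
      by (rule lborel.borel_measurable_lebesgue_integral) measurable
    moreover have "(LINT s:{0..max 0 t}|lborel. w x (max 0 s)) = y x (max 0 t)" if x: "x \<in> space M" for x
    proof -
      have "(w x has_integral (y x (max 0 t) - y x 0)) {0..max 0 t}"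
        using x by (intro fundamental_theorem_of_calculus)
          (auto intro!: DERIV_subset[OF y_deriv] simp flip: has_real_derivative_iff_has_vector_derivative)
      then have "((\<lambda>s. w x (max 0 s)) has_integral (y x (max 0 t) - y x 0)) {0..max 0 t}"
        by (rule has_integral_eq[rotated]) simp
      then have "((\<lambda>s. w x (max 0 s)) has_integral y x (max 0 t)) {0..max 0 t}"
        using y_0[OF x] by simp
      moreover have "set_integrable lborel {0..max 0 t} (\<lambda>s. w x (max 0 s))"
        by (intro borel_integrable_atLeastAtMost' continuous_on_subset[OF cm[OF cw[OF x]]]) auto
      ultimately show ?thesis
        by (metis (lifting) set_borel_integral_eq_integral(2) integral_unique)
    qed
    ultimately show ?thesis by (simp cong: measurable_cong)
  qed
  then show ym[measurable]: "(\<lambda>(x, t). y x (max 0 t)) \<in> borel_measurable (M \<Otimes>\<^sub>M lborel)"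
    using cm[OF cy] by (intro Caratheodory_measurable) auto
  \<comment> \<open>The increments are strictly positive, so the shifted times stay in the half-line
    and avoid the base point, as the one-sided derivative demands. The outer \<open>max 0\<close>
    changes nothing; it gives the shifted path the clipped form already known to be
    measurable.\<close>
  let ?h = "\<lambda>n. inverse (real (Suc n))"
  let ?D = "\<lambda>n x t. (w x (max 0 (max 0 t + ?h n)) - w x (max 0 t)) / ?h n"
  show "(\<lambda>(x, t). p x (max 0 t)) \<in> borel_measurable (M \<Otimes>\<^sub>M lborel)"
  proof (rule borel_measurable_LIMSEQ_real)
    fix n
    have "(\<lambda>z. (\<lambda>(x, t). w x (max 0 t)) (fst z, max 0 (snd z) + ?h n)) \<in> borel_measurable (M \<Otimes>\<^sub>M lborel)"
      by (rule measurable_compose[OF _ wm]) measurable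
    then have [measurable]: "(\<lambda>(x, t). w x (max 0 (max 0 t + ?h n))) \<in> borel_measurable (M \<Otimes>\<^sub>M lborel)"
      by (simp add: case_prod_beta)
    show "(\<lambda>(x, t). ?D n x t / \<gamma> + w x (max 0 t) + lam * y x (max 0 t))
        \<in> borel_measurable (M \<Otimes>\<^sub>M lborel)"
      by measurable
  next
    fix z assume z: "z \<in> space (M \<Otimes>\<^sub>M (lborel :: real measure))"
    obtain x t where xt: "z = (x, t)" "x \<in> space M"
      using z by (cases z) (auto simp: space_pair_measure)
    let ?t = "max 0 t"
    have "filterlim (\<lambda>n. ?t + ?h n) (at ?t within {0..}) sequentially"
      unfolding filterlim_at
      using tendsto_add[OF tendsto_const LIMSEQ_inverse_real_of_nat, of ?t] by (auto intro!: always_eventually)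
    moreover have "((\<lambda>s. (w x s - w x ?t) / (s - ?t)) \<longlongrightarrow> \<gamma> * (p x ?t - w x ?t - lam * y x ?t))
        (at ?t within {0..})"
      using w_deriv[OF xt(2), of ?t] by (simp add: has_field_derivative_iff)
    ultimately have "(\<lambda>n. (w x (?t + ?h n) - w x ?t) / (?t + ?h n - ?t))
        \<longlonglongrightarrow> \<gamma> * (p x ?t - w x ?t - lam * y x ?t)"
      by (rule filterlim_compose[rotated])
    then have "(\<lambda>n. ?D n x t) \<longlonglongrightarrow> \<gamma> * (p x ?t - w x ?t - lam * y x ?t)"
      by (simp add: max_def)
    then have "(\<lambda>n. ?D n x t / \<gamma> + w x ?t + lam * y x ?t)
        \<longlonglongrightarrow> \<gamma> * (p x ?t - w x ?t - lam * y x ?t) / \<gamma> + w x ?t + lam * y x ?t"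
      using \<open>0 < \<gamma>\<close> by (intro tendsto_intros) auto
    then show "(\<lambda>n. (\<lambda>(x, t). ?D n x t / \<gamma> + w x (max 0 t) + lam * y x (max 0 t)) z)
        \<longlonglongrightarrow> (\<lambda>(x, t). p x (max 0 t)) z"
      using \<open>0 < \<gamma>\<close> by (simp add: xt(1))
  qed
qed

lemma gaussian_rv_integrable_square:
  assumes "prob_space M" "gaussian_rv M Y"
  shows "integrable M (\<lambda>x. (Y x)\<^sup>2)"
proof -
  interpret prob_space M by fact
  have [measurable]: "Y \<in> borel_measurable M" using assms(2) by (simp add: gaussian_rv_def)
  consider \<mu> where "AE x in M. Y x = \<mu>"
    | \<mu> \<sigma> where "0 < \<sigma>" "distributed M lborel Y (normal_density \<mu> \<sigma>)"
    using assms(2) by (auto simp: gaussian_rv_def)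
  then show ?thesis
  proof cases
    case 1
    then have "AE x in M. \<mu>\<^sup>2 = (Y x)\<^sup>2" by eventually_elim simp
    then have "integrable M (\<lambda>x. \<mu>\<^sup>2) \<longleftrightarrow> integrable M (\<lambda>x. (Y x)\<^sup>2)"
      by (intro integrable_cong_AE) auto
    then show ?thesis by simp
  next
    case 2
    let ?n = "normal_density \<mu> \<sigma>"
    \<comment> \<open>The square expanded around the mean, since the known moments of the normal
      density are the central ones.\<close>
    have "integrable lborel (\<lambda>x. ?n x * (x - \<mu>)^2 + 2 * \<mu> * (?n x * (x - \<mu>)^1) + \<mu>\<^sup>2 * (?n x * (x - \<mu>)^0))"
      using integrable_normal_moment[OF 2(1)]
      by (intro Bochner_Integration.integrable_add integrable_mult_right)
    also have "(\<lambda>x. ?n x * (x - \<mu>)^2 + 2 * \<mu> * (?n x * (x - \<mu>)^1) + \<mu>\<^sup>2 * (?n x * (x - \<mu>)^0))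
        = (\<lambda>x. ?n x * x\<^sup>2)"
      by (rule ext) (simp add: power2_eq_square algebra_simps)
    finally show ?thesis
      using distributed_integrable[OF 2(2), of "\<lambda>x. x\<^sup>2"] by simp
  qed
qed

section \<open>Modal decomposition of the network\<close>

text \<open>Orthonormal vectors are independent, and as many of them as the dimension must span the
  space. Orthonormality also makes the indexing injective, so the sum over vectors becomes a sum
  over indices.\<close>

lemma orthonormal_family_Parseval:
  fixes u :: "'i \<Rightarrow> 'a::euclidean_space"
  assumes "finite A" "card A = DIM('a)"
    and orth: "\<And>\<alpha> \<beta>. \<alpha> \<in> A \<Longrightarrow> \<beta> \<in> A \<Longrightarrow> u \<alpha> \<bullet> u \<beta> = (if \<alpha> = \<beta> then 1 else 0)"
  shows "v \<bullet> v = (\<Sum>\<alpha>\<in>A. (u \<alpha> \<bullet> v)\<^sup>2)"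
proof -
  have inj: "inj_on u A"
    using orth by (metis inj_onI zero_neq_one)
  have pw: "pairwise orthogonal (u ` A)"
    using orth by (auto simp: pairwise_def orthogonal_def)
  have norm1: "\<And>x. x \<in> u ` A \<Longrightarrow> norm x = 1"
    using orth by (auto simp: norm_eq_1)
  then have "0 \<notin> u ` A" by force
  with pw have "independent (u ` A)"
    by (rule pairwise_orthogonal_independent)
  then have "v \<in> span (u ` A)"
    using card_ge_dim_independent[of "u ` A" UNIV] assms(2) by (auto simp: card_image[OF inj])
  with pw norm1 have "(\<Sum>i\<in>u ` A. (v \<bullet> i) *\<^sub>R i) = v"
    by (rule orthonormal_basis_expand[OF _ _ _ finite_imageI[OF assms(1)]])
  then have "v \<bullet> v = v \<bullet> (\<Sum>i\<in>u ` A. (v \<bullet> i) *\<^sub>R i)" by simp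
  also have "\<dots> = (\<Sum>\<alpha>\<in>A. (u \<alpha> \<bullet> v)\<^sup>2)"
    by (simp add: inner_sum_right sum.reindex[OF inj] power2_eq_square inner_commute)
  finally show ?thesis .
qed

lemma diag_matrix_mult_component [simp]: "(diag_matrix v *v x) $ i = v $ i * x $ i"
  by (simp add: diag_matrix_def matrix_vector_mult_def if_distrib[of "\<lambda>z. z * _"] sum.delta' cong: if_cong)

text \<open>The effort is the squared length of \<open>v\<close>, the deviation from the mean scaled
  by the square root of the damping. As \<open>u 1\<close> is proportional to those square roots,
  subtracting the damping-weighted mean is exactly the projection away from \<open>u 1\<close>. The
  other modes are orthogonal to \<open>u 1\<close>, so they do not notice the subtraction and may be
  evaluated on \<open>w\<close> itself.\<close>

lemma control_effort_modes:
  fixes d :: "real^'n::finite" and u :: "nat \<Rightarrow> real^'n"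
  assumes d_pos: "\<And>i. 0 < d $ i"
    and orth: "\<And>\<alpha> \<beta>. \<alpha> \<in> {1..CARD('n)} \<Longrightarrow> \<beta> \<in> {1..CARD('n)} \<Longrightarrow>
          u \<alpha> \<bullet> u \<beta> = (if \<alpha> = \<beta> then 1 else 0)"
    and u_1: "u 1 = (\<chi> i. sqrt (d $ i) / sqrt (\<Sum>k\<in>UNIV. d $ k))"
  shows "(w - mean_frequency d w) \<bullet> (diag_matrix d *v (w - mean_frequency d w))
    = (\<Sum>\<alpha>\<in>{2..CARD('n)}. ((\<chi> i. u \<alpha> $ i * sqrt (d $ i)) \<bullet> w)\<^sup>2)"
proof -
  define S where "S = (\<Sum>k\<in>UNIV. d $ k)"
  define \<mu> where "\<mu> = (\<Sum>k\<in>UNIV. d $ k * w $ k) / S"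
  have S: "0 < S" unfolding S_def using d_pos by (intro sum_pos) auto
  have mean: "mean_frequency d w $ i = \<mu>" for i by (simp add: mean_frequency_def \<mu>_def S_def)
  define v :: "real^'n" where "v = (\<chi> i. sqrt (d $ i) * (w $ i - \<mu>))"
  have "(w - mean_frequency d w) \<bullet> (diag_matrix d *v (w - mean_frequency d w)) = v \<bullet> v"
  proof -
    have "(sqrt (d $ i) * (w $ i - \<mu>)) * (sqrt (d $ i) * (w $ i - \<mu>))
        = (w $ i - \<mu>) * (d $ i * (w $ i - \<mu>))" for i
    proof -
      have "(sqrt (d $ i) * (w $ i - \<mu>)) * (sqrt (d $ i) * (w $ i - \<mu>))
          = (sqrt (d $ i) * sqrt (d $ i)) * ((w $ i - \<mu>) * (w $ i - \<mu>))" by (simp only: mult_ac)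
      then show ?thesis using d_pos[of i] by (simp add: mult_ac)
    qed
    then have "v \<bullet> v = (\<Sum>i\<in>UNIV. (w $ i - \<mu>) * (d $ i * (w $ i - \<mu>)))"
      unfolding inner_vec_def v_def by (intro sum.cong) simp_all
    then show ?thesis by (simp add: inner_vec_def mean)
  qed
  also have "\<dots> = (\<Sum>\<alpha>\<in>{1..CARD('n)}. (u \<alpha> \<bullet> v)\<^sup>2)"
    by (rule orthonormal_family_Parseval) (use orth in simp_all)
  also have "{1..CARD('n)} = insert 1 {2..CARD('n)}" by (auto simp: Suc_le_eq)
  also have "(\<Sum>\<alpha>\<in>insert 1 {2..CARD('n)}. (u \<alpha> \<bullet> v)\<^sup>2)
      = (u 1 \<bullet> v)\<^sup>2 + (\<Sum>\<alpha>\<in>{2..CARD('n)}. (u \<alpha> \<bullet> v)\<^sup>2)" by simp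
  also have "u 1 \<bullet> v = 0"
  proof -
    have "u 1 $ i * v $ i = (d $ i * w $ i - \<mu> * d $ i) / sqrt S" for i
    proof -
      have "u 1 $ i * v $ i = (sqrt (d $ i) * sqrt (d $ i)) * (w $ i - \<mu>) / sqrt S"
        unfolding u_1 v_def S_def by simp
      then show ?thesis using d_pos[of i] by (simp add: algebra_simps)
    qed
    then have "u 1 \<bullet> v = (\<Sum>i\<in>UNIV. (d $ i * w $ i - \<mu> * d $ i) / sqrt S)"
      by (simp add: inner_vec_def)
    also have "\<dots> = ((\<Sum>i\<in>UNIV. d $ i * w $ i) - \<mu> * S) / sqrt S"
      by (simp add: S_def sum_subtractf sum_distrib_left flip: sum_divide_distrib)
    finally show ?thesis using S by (simp add: \<mu>_def)
  qed
  also have "(\<Sum>\<alpha>\<in>{2..CARD('n)}. (u \<alpha> \<bullet> v)\<^sup>2)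
      = (\<Sum>\<alpha>\<in>{2..CARD('n)}. ((\<chi> i. u \<alpha> $ i * sqrt (d $ i)) \<bullet> w)\<^sup>2)"
  proof (rule sum.cong[OF refl])
    fix \<alpha> assume \<alpha>: "\<alpha> \<in> {2..CARD('n)}"
    then have "u \<alpha> \<bullet> u 1 = 0" using orth[of \<alpha> 1] by simp
    moreover have "u \<alpha> \<bullet> u 1 = (\<Sum>i\<in>UNIV. u \<alpha> $ i * sqrt (d $ i)) / sqrt S"
      unfolding u_1 by (simp add: inner_vec_def S_def sum_divide_distrib)
    ultimately have 0: "(\<Sum>i\<in>UNIV. u \<alpha> $ i * sqrt (d $ i)) = 0" using S by simp
    have "u \<alpha> \<bullet> v = (\<Sum>i\<in>UNIV. u \<alpha> $ i * sqrt (d $ i) * w $ i) - \<mu> * (\<Sum>i\<in>UNIV. u \<alpha> $ i * sqrt (d $ i))"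
      by (simp add: inner_vec_def v_def algebra_simps sum_subtractf sum_distrib_left)
    then show "(u \<alpha> \<bullet> v)\<^sup>2 = ((\<chi> i. u \<alpha> $ i * sqrt (d $ i)) \<bullet> w)\<^sup>2"
      using 0 by (simp add: inner_vec_def)
  qed
  finally show ?thesis by simp
qed

text \<open>The equation of motion is tested against \<open>r\<close>, while the coordinates are
  taken along \<open>q\<close>. Damping carries \<open>r\<close> to \<open>q\<close>; the
  eigenvector equation says that \<open>L\<close> carries \<open>r\<close> to
  \<open>lam *\<^sub>R q\<close>; and with a constant ratio inertia carries \<open>r\<close> to
  \<open>q\<close> divided by \<open>\<gamma>\<close>. Hence all three terms close in the same
  scalar coordinate.\<close>

lemma modal_dynamics:
  fixes d m v :: "real^'n::finite" and L :: "real^'n^'n"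
  assumes d_pos: "\<And>i. 0 < d $ i" and m_pos: "\<And>i. 0 < m $ i"
    and ratio: "\<And>i. d $ i / m $ i = \<gamma>"
    and sym: "transpose L = L"
    and eigen: "damped_laplacian d L *v v = lam *\<^sub>R v"
    and sol: "linear_swing_solution m d L P \<theta> \<omega>" and t: "0 \<le> t"
  defines "q \<equiv> \<chi> i. v $ i * sqrt (d $ i)" and "r \<equiv> \<chi> i. v $ i / sqrt (d $ i)"
  shows "((\<lambda>t. q \<bullet> \<theta> t) has_real_derivative q \<bullet> \<omega> t) (at t within {0..})"
    and "((\<lambda>t. q \<bullet> \<omega> t) has_real_derivative \<gamma> * (r \<bullet> P t - q \<bullet> \<omega> t - lam * (q \<bullet> \<theta> t))) (at t within {0..})"
proof -
  have inner_deriv: "((\<lambda>t. q \<bullet> f t) has_real_derivative q \<bullet> f') (at t within {0..})"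
    if "(f has_vector_derivative f') (at t within {0..})" for f f'
    using bounded_linear.has_vector_derivative[OF bounded_linear_inner_right that]
    by (simp add: has_real_derivative_iff_has_vector_derivative)
  show "((\<lambda>t. q \<bullet> \<theta> t) has_real_derivative q \<bullet> \<omega> t) (at t within {0..})"
    using sol t by (intro inner_deriv) (auto simp: linear_swing_solution_def)
  obtain a where a: "(\<omega> has_vector_derivative a) (at t within {0..})"
    and eq: "diag_matrix m *v a + diag_matrix d *v \<omega> t = P t - L *v \<theta> t"
    using sol t by (auto simp: linear_swing_solution_def)
  have "diag_matrix (\<chi> i. 1 / sqrt (d $ i)) *v v = r"
    by (simp add: vec_eq_iff r_def)
  then have "diag_matrix (\<chi> i. 1 / sqrt (d $ i)) *v (L *v r) = lam *\<^sub>R v"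
    using eigen by (simp add: damped_laplacian_def flip: matrix_vector_mul_assoc)
  then have "(L *v r) $ i / sqrt (d $ i) = lam * v $ i" for i
    by (auto simp: vec_eq_iff)
  moreover have "sqrt (d $ i) \<noteq> 0" for i
    using d_pos[of i] by simp
  ultimately have "(L *v r) $ i = lam * v $ i * sqrt (d $ i)" for i
    by (metis nonzero_divide_eq_eq)
  then have "(L *v r) $ i = lam * q $ i" for i
    by (simp add: q_def)
  then have "L *v r = lam *\<^sub>R q" by (simp add: vec_eq_iff)
  moreover have "r \<bullet> (L *v \<theta> t) = (L *v r) \<bullet> \<theta> t"
    by (metis dot_lmul_matrix sym vector_transpose_matrix)
  ultimately have Lr: "r \<bullet> (L *v \<theta> t) = lam * (q \<bullet> \<theta> t)" by simp
  have "q $ i * a $ i = \<gamma> * (r $ i * P t $ i - q $ i * \<omega> t $ i - r $ i * (L *v \<theta> t) $ i)" for i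
  proof -
    have "m $ i * a $ i + d $ i * \<omega> t $ i = P t $ i - (L *v \<theta> t) $ i"
      using arg_cong[OF eq, of "\<lambda>x. x $ i"] by simp
    then have ai: "m $ i * a $ i = P t $ i - (L *v \<theta> t) $ i - d $ i * \<omega> t $ i" by simp
    have q: "q $ i = r $ i * d $ i"
      using d_pos[of i] real_sqrt_mult_self[of "d $ i"] by (simp add: q_def r_def field_simps)
    moreover have "d $ i = \<gamma> * m $ i" using ratio[of i] m_pos[of i] by (simp add: field_simps)
    ultimately have "q $ i * a $ i = r $ i * \<gamma> * (m $ i * a $ i)" by simp
    also have "\<dots> = \<gamma> * (r $ i * P t $ i - r $ i * d $ i * \<omega> t $ i - r $ i * (L *v \<theta> t) $ i)"
      unfolding ai by (simp add: algebra_simps)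
    finally show ?thesis by (simp add: q)
  qed
  then have "q \<bullet> a = \<gamma> * (r \<bullet> P t - q \<bullet> \<omega> t - r \<bullet> (L *v \<theta> t))"
    by (simp add: inner_vec_def sum_subtractf sum_distrib_left right_diff_distrib)
  with inner_deriv[OF a] Lr
  show "((\<lambda>t. q \<bullet> \<omega> t) has_real_derivative \<gamma> * (r \<bullet> P t - q \<bullet> \<omega> t - lam * (q \<bullet> \<theta> t))) (at t within {0..})"
    by simp
qed

section \<open>A single mode driven by exponentially correlated noise\<close>

text \<open>Only second-order information about the forcing is kept. \<open>p_square\<close> is
  separate from \<open>p_cov\<close> because a non-integrable function has integral 0, so for
  \<open>c = 0\<close> the covariance formula would not guarantee finite variance. Measurability is
  stated on the whole time line, the dynamics only from 0 on; clipped paths satisfy both.\<close>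

locale noisy_oscillator = prob_space M for M :: "'a measure" +
  fixes y w p :: "'a \<Rightarrow> real \<Rightarrow> real" and \<gamma> lam \<tau> c :: real
  assumes \<gamma>_pos: "0 < \<gamma>" and lam_pos: "0 < lam" and \<tau>_pos: "0 < \<tau>"
    and y_0: "x \<in> space M \<Longrightarrow> y x 0 = 0"
    and w_0: "x \<in> space M \<Longrightarrow> w x 0 = 0"
    and y_deriv: "x \<in> space M \<Longrightarrow> 0 \<le> t \<Longrightarrow>
          (y x has_real_derivative w x t) (at t within {0..})"
    and w_deriv: "x \<in> space M \<Longrightarrow> 0 \<le> t \<Longrightarrow>
          (w x has_real_derivative \<gamma> * (p x t - w x t - lam * y x t)) (at t within {0..})"
    and y_meas [measurable]: "(\<lambda>(x, t). y x t) \<in> borel_measurable (M \<Otimes>\<^sub>M lborel)"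
    and w_meas [measurable]: "(\<lambda>(x, t). w x t) \<in> borel_measurable (M \<Otimes>\<^sub>M lborel)"
    and p_meas [measurable]: "(\<lambda>(x, t). p x t) \<in> borel_measurable (M \<Otimes>\<^sub>M lborel)"
    and p_square: "0 \<le> t \<Longrightarrow> integrable M (\<lambda>x. (p x t)\<^sup>2)"
    and p_cov: "0 \<le> s \<Longrightarrow> 0 \<le> t \<Longrightarrow> (\<integral>x. p x s * p x t \<partial>M) = c * exp (- \<bar>s - t\<bar> / \<tau>)"
begin

lemma slice_measurable [measurable]:
  "(\<lambda>x. y x t) \<in> borel_measurable M"
  "(\<lambda>x. w x t) \<in> borel_measurable M"
  "(\<lambda>x. p x t) \<in> borel_measurable M"
  by measurable

lemma continuous_y: "x \<in> space M \<Longrightarrow> continuous_on {0..} (y x)"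
  and continuous_w: "x \<in> space M \<Longrightarrow> continuous_on {0..} (w x)"
  by (auto intro!: DERIV_continuous_on y_deriv w_deriv)

lemma p_variance: "0 \<le> t \<Longrightarrow> (\<integral>x. (p x t)\<^sup>2 \<partial>M) = c"
  using p_cov[of t t] by (simp add: power2_eq_square)

lemma c_nonneg: "0 \<le> c"
proof -
  have "0 \<le> (\<integral>x. (p x 0)\<^sup>2 \<partial>M)" by simp
  then show ?thesis by (simp add: p_variance)
qed

text \<open>The expectation of the bound in \<open>oscillator_bound\<close> is at most
  \<open>C * (c / \<kappa>)\<close> whatever \<open>T\<close> is, because the variance of the
  forcing is constant and the weight has total mass below \<open>1 / \<kappa>\<close>. The two
  squares are then separated by dropping the other, nonnegative, term.\<close>

lemma uniform_second_moments:
  obtains K where "\<And>t. 0 \<le> t \<Longrightarrow> integrable M (\<lambda>x. (y x t)\<^sup>2)"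
    "\<And>t. 0 \<le> t \<Longrightarrow> integrable M (\<lambda>x. (w x t)\<^sup>2)"
    "\<And>t. 0 \<le> t \<Longrightarrow> (\<integral>x. (y x t)\<^sup>2 \<partial>M) \<le> K"
    "\<And>t. 0 \<le> t \<Longrightarrow> (\<integral>x. (w x t)\<^sup>2 \<partial>M) \<le> K"
proof -
  define \<kappa> where "\<kappa> = \<gamma> * lam / (3 * (lam + \<gamma>))"
  define C where "C = 2 + \<gamma> / (2 * lam)"
  have pos: "0 < \<kappa>" "0 < C"
    using \<gamma>_pos lam_pos by (auto simp: \<kappa>_def C_def intro!: divide_pos_pos add_pos_pos)
  have main: "integrable M (\<lambda>x. (w x T)\<^sup>2 / (2 * \<gamma>) + lam * (y x T)\<^sup>2) \<and>
      (\<integral>x. (w x T)\<^sup>2 / (2 * \<gamma>) + lam * (y x T)\<^sup>2 \<partial>M) \<le> C * (c / \<kappa>)" if "0 \<le> T" for T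
  proof -
    let ?f = "\<lambda>x t. exp (\<kappa> * (t - T)) * (p x t)\<^sup>2"
    have fm: "(\<lambda>(x, t). ?f x t) \<in> borel_measurable (M \<Otimes>\<^sub>M lborel)" by measurable
    have fi: "\<forall>t\<in>{0..T}. integrable M (\<lambda>x. ?f x t)"
      using p_square by simp
    have fb: "\<forall>t\<in>{0..T}. (\<integral>x. \<bar>?f x t\<bar> \<partial>M) \<le> c"
    proof
      fix t assume that: "t \<in> {0..T}"
      have "exp (\<kappa> * (t - T)) \<le> 1" using that pos by (simp add: mult_le_0_iff)
      then show "(\<integral>x. \<bar>?f x t\<bar> \<partial>M) \<le> c"
        using that c_nonneg by (simp add: abs_mult p_variance mult_left_le_one_le)
    qed
    note F = Fubini_bounded_expectation[OF sigma_finite_measure_axioms fm fi fb]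
    have bound: "AE x in M. (w x T)\<^sup>2 / (2 * \<gamma>) + lam * (y x T)\<^sup>2
        \<le> C * (LINT t:{0..T}|lborel. ?f x t)"
      using F(1) AE_space
    proof eventually_elim
      case (elim x)
      note S = set_borel_integral_eq_integral[OF elim(1)]
      show ?case unfolding S(2) C_def
        using oscillator_bound[OF \<gamma>_pos lam_pos \<open>0 \<le> T\<close>, of "y x" "w x" "p x"] S(1) elim(2)
          y_0 w_0 y_deriv w_deriv unfolding \<kappa>_def by blast
    qed
    have int: "integrable M (\<lambda>x. C * (LINT t:{0..T}|lborel. ?f x t))"
      using F(2) by simp
    have intV: "integrable M (\<lambda>x. (w x T)\<^sup>2 / (2 * \<gamma>) + lam * (y x T)\<^sup>2)"
      by (rule Bochner_Integration.integrable_bound[OF int])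
         (use bound \<gamma>_pos lam_pos in \<open>auto elim!: eventually_mono\<close>)
    have "(\<integral>x. (w x T)\<^sup>2 / (2 * \<gamma>) + lam * (y x T)\<^sup>2 \<partial>M)
        \<le> (\<integral>x. C * (LINT t:{0..T}|lborel. ?f x t) \<partial>M)"
      by (rule integral_mono_AE[OF intV int bound])
    also have "\<dots> = C * (LINT t:{0..T}|lborel. c * exp (\<kappa> * (t - T)))"
    proof -
      have "(LINT t:{0..T}|lborel. \<integral>x. ?f x t \<partial>M) = (LINT t:{0..T}|lborel. c * exp (\<kappa> * (t - T)))"
        by (intro set_lebesgue_integral_cong) (auto simp: p_variance)
      then show ?thesis using F(4) by simp
    qed
    also have "(LINT t:{0..T}|lborel. c * exp (\<kappa> * (t - T))) = c / \<kappa> * (1 - exp (- \<kappa> * T))"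
    proof -
      have "((\<lambda>t. c * exp (\<kappa> * (t - T))) has_integral
          (c / \<kappa> * exp (\<kappa> * (T - T)) - c / \<kappa> * exp (\<kappa> * (0 - T)))) {0..T}"
        using \<open>0 \<le> T\<close> pos
        by (intro fundamental_theorem_of_calculus)
           (auto intro!: derivative_eq_intros simp flip: has_real_derivative_iff_has_vector_derivative)
      moreover have "set_integrable lborel {0..T} (\<lambda>t. c * exp (\<kappa> * (t - T)))"
        by (intro borel_integrable_atLeastAtMost' continuous_intros)
      ultimately have "(LINT t:{0..T}|lborel. c * exp (\<kappa> * (t - T)))
          = c / \<kappa> * exp (\<kappa> * (T - T)) - c / \<kappa> * exp (\<kappa> * (0 - T))"
        by (metis (lifting) set_borel_integral_eq_integral(2) integral_unique)
      also have "c / \<kappa> * exp (\<kappa> * (T - T)) - c / \<kappa> * exp (\<kappa> * (0 - T)) = c / \<kappa> * (1 - exp (- \<kappa> * T))"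
        by (simp add: right_diff_distrib)
      finally show ?thesis .
    qed
    also have "C * (c / \<kappa> * (1 - exp (- \<kappa> * T))) \<le> C * (c / \<kappa> * 1)"
      using pos c_nonneg by (intro mult_left_mono) auto
    finally show ?thesis using intV by simp
  qed
  have iw: "integrable M (\<lambda>x. (w x T)\<^sup>2)" if "0 \<le> T" for T
  proof (rule Bochner_Integration.integrable_bound)
    show "integrable M (\<lambda>x. 2 * \<gamma> * ((w x T)\<^sup>2 / (2 * \<gamma>) + lam * (y x T)\<^sup>2))"
      using main[OF that] by (intro integrable_mult_right) simp
  qed (use \<gamma>_pos lam_pos in \<open>auto simp: distrib_left\<close>)
  have iy: "integrable M (\<lambda>x. (y x T)\<^sup>2)" if "0 \<le> T" for T
  proof (rule Bochner_Integration.integrable_bound)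
    show "integrable M (\<lambda>x. 1 / lam * ((w x T)\<^sup>2 / (2 * \<gamma>) + lam * (y x T)\<^sup>2))"
      using main[OF that] by (intro integrable_mult_right) simp
  qed (use \<gamma>_pos lam_pos in \<open>auto simp: distrib_left\<close>)
  have sum: "(\<integral>x. (w x T)\<^sup>2 \<partial>M) / (2 * \<gamma>) + lam * (\<integral>x. (y x T)\<^sup>2 \<partial>M) \<le> C * (c / \<kappa>)"
    "0 \<le> (\<integral>x. (w x T)\<^sup>2 \<partial>M) / (2 * \<gamma>)" "0 \<le> lam * (\<integral>x. (y x T)\<^sup>2 \<partial>M)" if "0 \<le> T" for T
    using main[OF that] iw[OF that] iy[OF that] \<gamma>_pos lam_pos by simp_all
  let ?K = "max (2 * \<gamma> * (C * (c / \<kappa>))) (C * (c / \<kappa>) / lam)"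
  show ?thesis
  proof (rule that[OF iy iw])
    fix T :: real assume "0 \<le> T"
    note s = sum[OF this]
    have "(\<integral>x. (w x T)\<^sup>2 \<partial>M) / (2 * \<gamma>) \<le> C * (c / \<kappa>)" using s by linarith
    then have "(\<integral>x. (w x T)\<^sup>2 \<partial>M) \<le> 2 * \<gamma> * (C * (c / \<kappa>))"
      using \<gamma>_pos by (simp add: pos_divide_le_eq mult_ac)
    then show "(\<integral>x. (w x T)\<^sup>2 \<partial>M) \<le> ?K" by simp
    have "lam * (\<integral>x. (y x T)\<^sup>2 \<partial>M) \<le> C * (c / \<kappa>)" using s by linarith
    then have "(\<integral>x. (y x T)\<^sup>2 \<partial>M) \<le> C * (c / \<kappa>) / lam"
      by (subst pos_le_divide_eq[OF lam_pos]) (simp only: mult.commute)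
    then show "(\<integral>x. (y x T)\<^sup>2 \<partial>M) \<le> ?K" by simp
  qed
qed

text \<open>The covariances with \<open>p x t\<close> satisfy the system of
  \<open>cross_covariance_limit\<close> on \<open>s \<le> t\<close>, where the kink of the noise
  covariance at \<open>s = t\<close> is only an endpoint. Differentiating under the expectation
  would need control of the derivatives, so the system is first derived in integrated form by
  Fubini.\<close>

lemma work_rate:
  assumes "0 \<le> t"
  defines "b \<equiv> c / (lam * \<tau> + 1 + inverse \<gamma> * inverse \<tau>)"
  shows "\<bar>(\<integral>x. w x t * p x t \<partial>M) - b\<bar> \<le> \<bar>b\<bar> * sqrt (1 + \<gamma> * lam * \<tau>\<^sup>2) * exp (- t / \<tau>)"
proof -
  obtain K where
    iy: "\<And>t. 0 \<le> t \<Longrightarrow> integrable M (\<lambda>x. (y x t)\<^sup>2)" and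
    iw: "\<And>t. 0 \<le> t \<Longrightarrow> integrable M (\<lambda>x. (w x t)\<^sup>2)" and
    Ky: "\<And>t. 0 \<le> t \<Longrightarrow> (\<integral>x. (y x t)\<^sup>2 \<partial>M) \<le> K" and
    Kw: "\<And>t. 0 \<le> t \<Longrightarrow> (\<integral>x. (w x t)\<^sup>2 \<partial>M) \<le> K"
    using uniform_second_moments by blast
  let ?q = "\<lambda>x. p x t"
  define F where "F s = (\<integral>x. w x s * ?q x \<partial>M)" for s
  define \<Phi> where "\<Phi> s = (\<integral>x. y x s * ?q x \<partial>M)" for s
  note prod = integrable_mult_if_squares[OF slice_measurable(1) slice_measurable(3) iy p_square]
    integrable_mult_if_squares[OF slice_measurable(2) slice_measurable(3) iw p_square]
    integrable_mult_if_squares[OF slice_measurable(3) slice_measurable(3) p_square p_square]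
  define g where "g s = \<gamma> * (c * exp (- (t - s) / \<tau>) - F s - lam * \<Phi> s)" for s
  have \<Phi>: "set_integrable lborel {0..r} F" "\<Phi> r = integral {0..r} F" if "r \<in> {0..t}" for r
  proof -
    let ?f = "\<lambda>x s. w x s * ?q x"
    have fm: "(\<lambda>(x, s). ?f x s) \<in> borel_measurable (M \<Otimes>\<^sub>M lborel)" by measurable
    have fi: "\<forall>s\<in>{0..r}. integrable M (\<lambda>x. ?f x s)"
      using \<open>0 \<le> t\<close> by (auto intro!: prod)
    have fb: "\<forall>s\<in>{0..r}. (\<integral>x. \<bar>?f x s\<bar> \<partial>M) \<le> K + c"
    proof
      fix s assume "s \<in> {0..r}"
      then show "(\<integral>x. \<bar>?f x s\<bar> \<partial>M) \<le> K + c"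
        using \<open>0 \<le> t\<close> prod(4)[of s t] Kw[of s] by (simp add: p_variance)
    qed
    note Fub = Fubini_bounded_expectation[OF sigma_finite_measure_axioms fm fi fb]
    show i: "set_integrable lborel {0..r} F" unfolding F_def by (rule Fub)
    have "\<Phi> r = (\<integral>x. (LINT s:{0..r}|lborel. ?f x s) \<partial>M)" unfolding \<Phi>_def
    proof (rule Bochner_Integration.integral_cong[OF refl])
      fix x assume x: "x \<in> space M"
      have "(w x has_integral (y x r - y x 0)) {0..r}"
        using that x by (intro fundamental_theorem_of_calculus)
          (auto intro!: DERIV_subset[OF y_deriv] simp flip: has_real_derivative_iff_has_vector_derivative)
      then have "((\<lambda>s. ?f x s) has_integral (y x r * ?q x)) {0..r}"
        using y_0[OF x] by (simp add: has_integral_mult_left)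
      moreover have "set_integrable lborel {0..r} (\<lambda>s. ?f x s)"
        by (intro borel_integrable_atLeastAtMost' continuous_intros)
           (rule continuous_on_subset[OF continuous_w[OF x]], auto)
      ultimately show "y x r * ?q x = (LINT s:{0..r}|lborel. ?f x s)"
        using set_borel_integral_eq_integral(2) integral_unique by metis
    qed
    also have "\<dots> = (LINT s:{0..r}|lborel. F s)" unfolding F_def by (rule Fub)
    also have "\<dots> = integral {0..r} F" by (rule set_borel_integral_eq_integral[OF i])
    finally show "\<Phi> r = integral {0..r} F" .
  qed
  have F: "set_integrable lborel {0..r} g" "F r = integral {0..r} g" if "r \<in> {0..t}" for r
  proof -
    let ?f = "\<lambda>x s. \<gamma> * (p x s * ?q x - w x s * ?q x - lam * (y x s * ?q x))"
    have fm: "(\<lambda>(x, s). ?f x s) \<in> borel_measurable (M \<Otimes>\<^sub>M lborel)" by measurable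
    have fi: "\<forall>s\<in>{0..r}. integrable M (\<lambda>x. ?f x s)"
      using \<open>0 \<le> t\<close>
      by (intro ballI prod integrable_mult_right Bochner_Integration.integrable_diff) auto
    have fb: "\<forall>s\<in>{0..r}. (\<integral>x. \<bar>?f x s\<bar> \<partial>M) \<le> \<gamma> * ((c + c) + (K + c) + lam * (K + c))"
    proof
      fix s assume that: "s \<in> {0..r}"
      have s: "0 \<le> s" using that by auto
      have "(\<integral>x. \<bar>?f x s\<bar> \<partial>M)
          \<le> (\<integral>x. \<gamma> * (\<bar>p x s * ?q x\<bar> + \<bar>w x s * ?q x\<bar> + lam * \<bar>y x s * ?q x\<bar>) \<partial>M)"
      proof (rule integral_mono)
        show "integrable M (\<lambda>x. \<bar>?f x s\<bar>)" using bspec[OF fi that] by (rule integrable_abs)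
        show "integrable M (\<lambda>x. \<gamma> * (\<bar>p x s * ?q x\<bar> + \<bar>w x s * ?q x\<bar> + lam * \<bar>y x s * ?q x\<bar>))"
          using s \<open>0 \<le> t\<close>
          by (intro prod integrable_mult_right Bochner_Integration.integrable_add integrable_abs)
        show "\<bar>?f x s\<bar> \<le> \<gamma> * (\<bar>p x s * ?q x\<bar> + \<bar>w x s * ?q x\<bar> + lam * \<bar>y x s * ?q x\<bar>)" for x
        proof -
          have "\<bar>lam * (y x s * ?q x)\<bar> = lam * \<bar>y x s * ?q x\<bar>"
            using lam_pos by (simp only: abs_mult abs_of_pos)
          then have "\<bar>p x s * ?q x - w x s * ?q x - lam * (y x s * ?q x)\<bar>
              \<le> \<bar>p x s * ?q x\<bar> + \<bar>w x s * ?q x\<bar> + lam * \<bar>y x s * ?q x\<bar>"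
            by linarith
          then show ?thesis
            unfolding abs_mult[of \<gamma>] using \<gamma>_pos by (simp add: abs_of_pos)
        qed
      qed
      also have "\<dots> = \<gamma> * ((\<integral>x. \<bar>p x s * ?q x\<bar> \<partial>M) + (\<integral>x. \<bar>w x s * ?q x\<bar> \<partial>M)
          + lam * (\<integral>x. \<bar>y x s * ?q x\<bar> \<partial>M))"
        using prod(1,3,5)[OF s \<open>0 \<le> t\<close>] by (simp del: abs_mult add: integrable_abs)
      also have "\<dots> \<le> \<gamma> * ((c + c) + (K + c) + lam * (K + c))"
      proof (intro mult_left_mono add_mono)
        show "(\<integral>x. \<bar>p x s * ?q x\<bar> \<partial>M) \<le> c + c" "(\<integral>x. \<bar>w x s * ?q x\<bar> \<partial>M) \<le> K + c"
          "(\<integral>x. \<bar>y x s * ?q x\<bar> \<partial>M) \<le> K + c"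
          using prod(2,4,6)[OF s \<open>0 \<le> t\<close>] Kw[OF s] Ky[OF s]
          by (simp_all add: p_variance[OF s] p_variance[OF \<open>0 \<le> t\<close>])
      qed (use \<gamma>_pos lam_pos in auto)
      finally show "(\<integral>x. \<bar>?f x s\<bar> \<partial>M) \<le> \<gamma> * ((c + c) + (K + c) + lam * (K + c))" .
    qed
    note Fub = Fubini_bounded_expectation[OF sigma_finite_measure_axioms fm fi fb]
    have g: "(\<integral>x. ?f x s \<partial>M) = g s" if "s \<in> {0..r}" for s
    proof -
      have s: "0 \<le> s" "s \<le> t" using that \<open>r \<in> {0..t}\<close> by auto
      have "(\<integral>x. ?f x s \<partial>M) = \<gamma> * ((\<integral>x. p x s * ?q x \<partial>M) - F s - lam * \<Phi> s)"
        unfolding F_def \<Phi>_def using prod(1,3,5)[OF s(1) \<open>0 \<le> t\<close>] by simp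
      then show ?thesis using s \<open>0 \<le> t\<close> by (simp add: g_def p_cov)
    qed
    show i: "set_integrable lborel {0..r} g"
    proof -
      have "set_integrable lborel {0..r} (\<lambda>s. \<integral>x. ?f x s \<partial>M) = set_integrable lborel {0..r} g"
        by (intro set_integrable_cong refl g)
      then show ?thesis using Fub(3) by (rule iffD1)
    qed
    have "F r = (\<integral>x. (LINT s:{0..r}|lborel. ?f x s) \<partial>M)" unfolding F_def
    proof (rule integral_cong_AE)
      \<comment> \<open>The increment of \<open>w\<close> is a gauge integral on every path. Unlike
        for \<open>\<Phi>\<close>, whose integrand is continuous, the integrand contains
        \<open>p\<close>, so equality with the Lebesgue integral is known only on almost every
        path.\<close>
      show "AE x in M. w x r * ?q x = (LINT s:{0..r}|lborel. ?f x s)"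
        using Fub(1) AE_space
      proof eventually_elim
        case (elim x)
        have "((\<lambda>s. \<gamma> * (p x s - w x s - lam * y x s)) has_integral (w x r - w x 0)) {0..r}"
          using that elim by (intro fundamental_theorem_of_calculus)
            (auto intro!: DERIV_subset[OF w_deriv] simp flip: has_real_derivative_iff_has_vector_derivative)
        from has_integral_mult_left[OF this, of "?q x"]
        have "((\<lambda>s. ?f x s) has_integral (w x r * ?q x)) {0..r}"
          using w_0[OF elim(2)] by (simp add: algebra_simps)
        then show ?case
          unfolding set_borel_integral_eq_integral(2)[OF elim(1)] by (rule integral_unique[symmetric])
      qed
    qed (use Fub(2) in measurable)
    also have "\<dots> = (LINT s:{0..r}|lborel. g s)" unfolding Fub(4)
      by (intro set_lebesgue_integral_cong allI impI g) auto
    also have "\<dots> = integral {0..r} g" by (rule set_borel_integral_eq_integral[OF i])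
    finally show "F r = integral {0..r} g" .
  qed
  have tt: "t \<in> {0..t}" using \<open>0 \<le> t\<close> by auto
  \<comment> \<open>Bootstrapping: as indefinite integrals \<open>F\<close> and
    \<open>\<Phi>\<close> are continuous; hence so is \<open>g\<close>, in which the noise enters
    only through its covariance, and the integral equations may be differentiated.\<close>
  have cF: "continuous_on {0..t} F"
    using indefinite_integral_continuous_1[OF set_borel_integral_eq_integral(1)[OF F(1)[OF tt]]]
    by (rule continuous_on_cong[THEN iffD1, rotated -1, OF _ refl]) (simp add: F(2))
  have c\<Phi>: "continuous_on {0..t} \<Phi>"
    using indefinite_integral_continuous_1[OF set_borel_integral_eq_integral(1)[OF \<Phi>(1)[OF tt]]]
    by (rule continuous_on_cong[THEN iffD1, rotated -1, OF _ refl]) (simp add: \<Phi>(2))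
  have cg: "continuous_on {0..t} g"
    unfolding g_def using \<tau>_pos by (intro continuous_intros cF c\<Phi>) auto
  have dF: "(F has_real_derivative g s) (at s within {0..t})" if "s \<in> {0..t}" for s
    using integral_has_real_derivative[OF cg that]
    by (rule has_field_derivative_transform_within[OF _ zero_less_one that]) (simp add: F(2))
  have d\<Phi>: "(\<Phi> has_real_derivative F s) (at s within {0..t})" if "s \<in> {0..t}" for s
    using integral_has_real_derivative[OF cF that]
    by (rule has_field_derivative_transform_within[OF _ zero_less_one that]) (simp add: \<Phi>(2))
  have "F 0 = 0" "\<Phi> 0 = 0" using F(2)[of 0] \<Phi>(2)[of 0] \<open>0 \<le> t\<close> by auto
  from cross_covariance_limit[OF \<gamma>_pos lam_pos \<tau>_pos \<open>0 \<le> t\<close> this d\<Phi> dF[unfolded g_def]]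
  show ?thesis by (simp add: b_def F_def)
qed

text \<open>The integrand is continuous in time on every path, so gauge and Lebesgue integrals agree
  without exception and the effort inherits measurability and finite expectation from
  Fubini.\<close>

lemma integrable_square_effort:
  assumes "0 \<le> T"
  shows "integrable M (\<lambda>x. integral {0..T} (\<lambda>t. (w x t)\<^sup>2))"
proof -
  obtain K where
    "\<And>t. 0 \<le> t \<Longrightarrow> integrable M (\<lambda>x. (y x t)\<^sup>2)" and
    iw: "\<And>t. 0 \<le> t \<Longrightarrow> integrable M (\<lambda>x. (w x t)\<^sup>2)" and
    "\<And>t. 0 \<le> t \<Longrightarrow> (\<integral>x. (y x t)\<^sup>2 \<partial>M) \<le> K" and
    Kw: "\<And>t. 0 \<le> t \<Longrightarrow> (\<integral>x. (w x t)\<^sup>2 \<partial>M) \<le> K"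
    using uniform_second_moments by blast
  have "integrable M (\<lambda>x. LINT t:{0..T}|lborel. (w x t)\<^sup>2)"
  proof (rule Fubini_bounded_expectation(2)[OF sigma_finite_measure_axioms, where K = K])
    show "(\<lambda>(x, t). (w x t)\<^sup>2) \<in> borel_measurable (M \<Otimes>\<^sub>M lborel)" by measurable
  qed (simp_all add: iw Kw)
  moreover have "(LINT t:{0..T}|lborel. (w x t)\<^sup>2) = integral {0..T} (\<lambda>t. (w x t)\<^sup>2)"
    if "x \<in> space M" for x
    by (intro set_borel_integral_eq_integral borel_integrable_atLeastAtMost' continuous_intros
          continuous_on_subset[OF continuous_w[OF that]]) auto
  ultimately show ?thesis
    by (simp cong: Bochner_Integration.integrable_cong)
qed

text \<open>The error of the work rate decays exponentially with time constant
  \<open>\<tau>\<close>, so its integral over all times is at most \<open>\<tau>\<close> times its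
  initial bound. The estimate is free of \<open>T\<close> and disappears after division by
  \<open>T\<close>.\<close>

lemma total_work_approx:
  assumes "0 \<le> T"
  defines "b \<equiv> c / (lam * \<tau> + 1 + inverse \<gamma> * inverse \<tau>)"
  shows "\<bar>(LINT t:{0..T}|lborel. \<integral>x. w x t * p x t \<partial>M) - T * b\<bar>
      \<le> \<bar>b\<bar> * sqrt (1 + \<gamma> * lam * \<tau>\<^sup>2) * \<tau>"
proof -
  define B where "B = \<bar>b\<bar> * sqrt (1 + \<gamma> * lam * \<tau>\<^sup>2)"
  define r where "r t = (\<integral>x. w x t * p x t \<partial>M)" for t
  have B0: "0 \<le> B" using \<gamma>_pos lam_pos by (simp add: B_def)
  have r: "norm (r t - b) \<le> B * exp (- t / \<tau>)" if "t \<in> {0..T}" for t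
    using work_rate[of t] that by (simp add: r_def B_def b_def)
  have rm[measurable]: "r \<in> borel_measurable lborel" unfolding r_def by measurable
  have E: "set_integrable lborel {0..T} (\<lambda>t. B * exp (- t / \<tau>))"
    using \<tau>_pos by (intro borel_integrable_atLeastAtMost' continuous_intros) auto
  have 1: "set_integrable lborel {0..T} (\<lambda>t. r t - b)"
  proof (rule set_integrable_bound[OF E])
    show "set_borel_measurable lborel {0..T} (\<lambda>t. r t - b)"
      unfolding set_borel_measurable_def by measurable
    show "AE t in lborel. t \<in> {0..T} \<longrightarrow> norm (r t - b) \<le> norm (B * exp (- t / \<tau>))"
      using r B0 by (auto intro!: AE_I2 intro: order_trans[OF _ abs_ge_self])
  qed
  have b: "set_integrable lborel {0..T} (\<lambda>t. b)"
    by (intro borel_integrable_atLeastAtMost' continuous_intros)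
  have "(LINT t:{0..T}|lborel. r t) = (LINT t:{0..T}|lborel. (r t - b) + b)" by simp
  also have "\<dots> = (LINT t:{0..T}|lborel. r t - b) + (LINT t:{0..T}|lborel. b)"
    by (rule set_integral_add(2)[OF 1 b])
  also have "(LINT t:{0..T}|lborel. b) = T * b"
    using \<open>0 \<le> T\<close> set_borel_integral_eq_integral(2)[OF b] by simp
  finally have eq: "(LINT t:{0..T}|lborel. r t) - T * b = (LINT t:{0..T}|lborel. r t - b)" by simp
  note S = set_borel_integral_eq_integral[OF 1]
  have ex: "((\<lambda>t. B * exp (- t / \<tau>)) has_integral
      (- B * \<tau> * exp (- T / \<tau>) - (- B * \<tau> * exp (- 0 / \<tau>)))) {0..T}"
    using \<open>0 \<le> T\<close> \<tau>_pos
    by (intro fundamental_theorem_of_calculus)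
       (auto intro!: derivative_eq_intros simp flip: has_real_derivative_iff_has_vector_derivative)
  have "norm (integral {0..T} (\<lambda>t. r t - b)) \<le> integral {0..T} (\<lambda>t. B * exp (- t / \<tau>))"
    by (rule integral_norm_bound_integral[OF S(1) has_integral_integrable[OF ex] r])
  also have "\<dots> = B * \<tau> * (1 - exp (- T / \<tau>))"
    using integral_unique[OF ex] by (simp add: algebra_simps)
  also have "\<dots> \<le> B * \<tau> * 1"
    using B0 \<tau>_pos by (intro mult_left_mono) auto
  finally show ?thesis
    using eq S(2) by (simp add: r_def B_def)
qed

text \<open>By the energy balance the expected dissipation is the expected work minus the expected
  final energy, that is \<open>T * b\<close> up to a bounded error. The time average thus converges
  at rate \<open>1 / T\<close>.\<close>

lemma mean_square_effort_limit:
  "((\<lambda>T. inverse T * (\<integral>x. integral {0..T} (\<lambda>t. (w x t)\<^sup>2) \<partial>M))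
      \<longlongrightarrow> c / (lam * \<tau> + 1 + inverse \<gamma> * inverse \<tau>)) at_top"
proof -
  define b where "b = c / (lam * \<tau> + 1 + inverse \<gamma> * inverse \<tau>)"
  define B where "B = \<bar>b\<bar> * sqrt (1 + \<gamma> * lam * \<tau>\<^sup>2) * \<tau>"
  define I where "I T = (\<integral>x. integral {0..T} (\<lambda>t. (w x t)\<^sup>2) \<partial>M)" for T
  obtain K where
    iy: "\<And>t. 0 \<le> t \<Longrightarrow> integrable M (\<lambda>x. (y x t)\<^sup>2)" and
    iw: "\<And>t. 0 \<le> t \<Longrightarrow> integrable M (\<lambda>x. (w x t)\<^sup>2)" and
    Ky: "\<And>t. 0 \<le> t \<Longrightarrow> (\<integral>x. (y x t)\<^sup>2 \<partial>M) \<le> K" and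
    Kw: "\<And>t. 0 \<le> t \<Longrightarrow> (\<integral>x. (w x t)\<^sup>2 \<partial>M) \<le> K"
    using uniform_second_moments by blast
  note prod = integrable_mult_if_squares[OF slice_measurable(2) slice_measurable(3) iw p_square]
  \<comment> \<open>\<open>B\<close> accounts for the relaxation of the work rate, the other summand
    for the energy still stored at time \<open>T\<close>.\<close>
  define D where "D = B + (K / \<gamma> + lam * K) / 2"
  have bound: "\<bar>I T - T * b\<bar> \<le> D" if "0 \<le> T" for T
  proof -
    let ?f = "\<lambda>x t. w x t * p x t"
    let ?E = "\<lambda>x. ((w x T)\<^sup>2 / \<gamma> + lam * (y x T)\<^sup>2) / 2"
    have fm: "(\<lambda>(x, t). ?f x t) \<in> borel_measurable (M \<Otimes>\<^sub>M lborel)" by measurable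
    have fi: "\<forall>t\<in>{0..T}. integrable M (\<lambda>x. ?f x t)"
      by (auto intro!: prod)
    have fb: "\<forall>t\<in>{0..T}. (\<integral>x. \<bar>?f x t\<bar> \<partial>M) \<le> K + c"
    proof
      fix t assume "t \<in> {0..T}"
      then show "(\<integral>x. \<bar>?f x t\<bar> \<partial>M) \<le> K + c"
        using prod(2)[of t t] Kw[of t] by (simp add: p_variance)
    qed
    note Fub = Fubini_bounded_expectation[OF sigma_finite_measure_axioms fm fi fb]
    have iE: "integrable M ?E"
      using iw[OF that] iy[OF that] by simp
    have "I T = (\<integral>x. (LINT t:{0..T}|lborel. ?f x t) - ?E x \<partial>M)"
      unfolding I_def
    proof (rule integral_cong_AE)
      show "AE x in M. integral {0..T} (\<lambda>t. (w x t)\<^sup>2) = (LINT t:{0..T}|lborel. ?f x t) - ?E x"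
        using Fub(1) AE_space
      proof eventually_elim
        case (elim x)
        note S = set_borel_integral_eq_integral[OF elim(1)]
        have "((\<lambda>t. ?f x t - (w x t)\<^sup>2) has_integral ?E x) {0..T}"
          using oscillator_energy_balance[OF \<gamma>_pos that y_0 w_0 y_deriv w_deriv] elim(2) by blast
        from has_integral_diff[OF integrable_integral[OF S(1)] this]
        have "((\<lambda>t. (w x t)\<^sup>2) has_integral integral {0..T} (?f x) - ?E x) {0..T}" by simp
        then show ?case unfolding S(2) by (rule integral_unique)
      qed
      show "(\<lambda>x. integral {0..T} (\<lambda>t. (w x t)\<^sup>2)) \<in> borel_measurable M"
        using integrable_square_effort[OF that] by (rule borel_measurable_integrable)
      show "(\<lambda>x. (LINT t:{0..T}|lborel. ?f x t) - ?E x) \<in> borel_measurable M"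
        using Fub(2) iE by (intro borel_measurable_integrable Bochner_Integration.integrable_diff)
    qed
    also have "\<dots> = (\<integral>x. (LINT t:{0..T}|lborel. ?f x t) \<partial>M) - (\<integral>x. ?E x \<partial>M)"
      using Fub(2) iE by (rule Bochner_Integration.integral_diff)
    also have "(\<integral>x. (LINT t:{0..T}|lborel. ?f x t) \<partial>M) = (LINT t:{0..T}|lborel. \<integral>x. ?f x t \<partial>M)"
      by (rule Fub(4))
    finally have "I T = (LINT t:{0..T}|lborel. \<integral>x. ?f x t \<partial>M) - (\<integral>x. ?E x \<partial>M)" .
    moreover have "\<bar>(LINT t:{0..T}|lborel. \<integral>x. ?f x t \<partial>M) - T * b\<bar> \<le> B"
      unfolding b_def B_def by (rule total_work_approx[OF that])
    moreover have "0 \<le> (\<integral>x. ?E x \<partial>M)"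
      using \<gamma>_pos lam_pos by (intro Bochner_Integration.integral_nonneg) simp
    moreover have "(\<integral>x. ?E x \<partial>M) \<le> (K / \<gamma> + lam * K) / 2"
    proof -
      have "(\<integral>x. ?E x \<partial>M) = ((\<integral>x. (w x T)\<^sup>2 \<partial>M) / \<gamma> + lam * (\<integral>x. (y x T)\<^sup>2 \<partial>M)) / 2"
        using iw[OF that] iy[OF that] by simp
      also have "\<dots> \<le> (K / \<gamma> + lam * K) / 2"
        using Kw[OF that] Ky[OF that] \<gamma>_pos lam_pos
        by (intro divide_right_mono add_mono mult_left_mono) auto
      finally show ?thesis .
    qed
    ultimately show ?thesis unfolding D_def by linarith
  qed
  have "((\<lambda>T. inverse T * I T - b) \<longlongrightarrow> 0) at_top"
  proof (rule Lim_null_comparison)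
    show "\<forall>\<^sub>F T in at_top. norm (inverse T * I T - b) \<le> D * inverse T"
    proof (rule eventually_mono[OF eventually_gt_at_top[of 0]])
      fix T :: real assume T: "0 < T"
      then have "inverse T * I T - b = inverse T * (I T - T * b)"
        by (simp add: field_simps)
      then show "norm (inverse T * I T - b) \<le> D * inverse T"
        using bound[of T] T by (simp add: abs_mult mult.commute[of D] mult_left_mono)
    qed
    show "((\<lambda>T. D * inverse T) \<longlongrightarrow> 0) at_top"
      by (intro tendsto_mult_right_zero tendsto_inverse_0_at_top filterlim_ident)
  qed
  then show ?thesis
    unfolding I_def b_def by (rule LIM_zero_cancel)
qed

end

section \<open>Superposition of the modes\<close>

theorem mainTheorem2:
  fixes b :: "'n::finite \<Rightarrow> 'n \<Rightarrow> real"
    and m d P \<theta>0 :: "real^'n"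
    and L :: "real^'n^'n"
    and u :: "nat \<Rightarrow> real^'n" and lam :: "nat \<Rightarrow> real"
    and \<gamma> \<tau>0 :: real
    and M :: "'a measure"
    and N :: "'n set" and \<delta>P0 :: "'n \<Rightarrow> real"
    and \<delta>P \<delta>\<theta> \<omega> :: "'a \<Rightarrow> real \<Rightarrow> real^'n"
  assumes b_sym: "\<And>i j. b i j = b j i"
    and b_nonneg: "\<And>i j. 0 \<le> b i j"
    and m_pos: "\<And>i. 0 < m $ i"
    and d_pos: "\<And>i. 0 < d $ i"
    and stationary: "swing_solution b m d P (\<lambda>_. \<theta>0) (\<lambda>_. 0)"
    and L_eq: "L = weighted_laplacian b \<theta>0"
    and L_psd: "pos_semidef L"
    and L_simple_zero: "dim {x. L *v x = 0} = 1"
    and L_zero_vec: "L *v (\<chi> i. 1 / sqrt (real CARD('n))) = 0"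
    and u_eigen: "\<And>\<alpha>. \<alpha> \<in> {1..CARD('n)} \<Longrightarrow> damped_laplacian d L *v u \<alpha> = lam \<alpha> *\<^sub>R u \<alpha>"
    and u_orthonormal: "\<And>\<alpha> \<beta>. \<alpha> \<in> {1..CARD('n)} \<Longrightarrow> \<beta> \<in> {1..CARD('n)} \<Longrightarrow>
          u \<alpha> \<bullet> u \<beta> = (if \<alpha> = \<beta> then 1 else 0)"
    and u_1: "u 1 = (\<chi> i. sqrt (d $ i) / sqrt (\<Sum>k\<in>UNIV. d $ k))"
    and lam_1: "lam 1 = 0"
    and lam_pos: "\<And>\<alpha>. \<alpha> \<in> {2..CARD('n)} \<Longrightarrow> 0 < lam \<alpha>"
    and \<gamma>_pos: "0 < \<gamma>"
    and ratio: "\<And>i. d $ i / m $ i = \<gamma>"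
    and prob: "prob_space M"
    and \<tau>0_pos: "0 < \<tau>0"
    and noise_off: "\<And>x t i. x \<in> space M \<Longrightarrow> 0 \<le> t \<Longrightarrow> i \<notin> N \<Longrightarrow> \<delta>P x t $ i = 0"
    and noise_gaussian: "gaussian_family M (N \<times> {0..}) (\<lambda>(i, t) x. \<delta>P x t $ i)"
    and noise_mean: "\<And>i t. i \<in> N \<Longrightarrow> 0 \<le> t \<Longrightarrow> (\<integral>x. \<delta>P x t $ i \<partial>M) = 0"
    and noise_cov: "\<And>i j t t'. i \<in> N \<Longrightarrow> j \<in> N \<Longrightarrow> 0 \<le> t \<Longrightarrow> 0 \<le> t' \<Longrightarrow>
          (\<integral>x. \<delta>P x t $ i * \<delta>P x t' $ j \<partial>M)
          = (if i = j then (\<delta>P0 i)\<^sup>2 * exp (- \<bar>t - t'\<bar> / \<tau>0) else 0)"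
    and \<omega>_random: "\<And>t. 0 \<le> t \<Longrightarrow> (\<lambda>x. \<omega> x t) \<in> borel_measurable M"
    and dynamics: "\<And>x. x \<in> space M \<Longrightarrow> linear_swing_solution m d L (\<delta>P x) (\<delta>\<theta> x) (\<omega> x)"
  shows "(\<forall>T>0. integrable M (\<lambda>x. control_effort d (\<omega> x) T)) \<and>
    ((\<lambda>T. \<integral>x. control_effort d (\<omega> x) T \<partial>M) \<longlongrightarrow>
      (\<Sum>\<alpha>\<in>{2..CARD('n)}.
        (\<Sum>i\<in>N. (\<delta>P0 i)\<^sup>2 * (u \<alpha> $ i)\<^sup>2 * inverse (d $ i)) /
        (lam \<alpha> * \<tau>0 + 1 + inverse \<gamma> * inverse \<tau>0))) at_top"
proof -
  interpret prob_space M by (rule prob)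
  define q where "q \<alpha> = (\<chi> i. u \<alpha> $ i * sqrt (d $ i))" for \<alpha>
  define r where "r \<alpha> = (\<chi> i. u \<alpha> $ i / sqrt (d $ i))" for \<alpha>
  define c where "c \<alpha> = (\<Sum>i\<in>N. (\<delta>P0 i)\<^sup>2 * (u \<alpha> $ i)\<^sup>2 * inverse (d $ i))" for \<alpha>
  \<comment> \<open>Clipping freezes every path at its initial value for negative times, so that the
    processes are defined and measurable on the whole line without any statement about the
    past.\<close>
  define Y where "Y \<alpha> x t = q \<alpha> \<bullet> \<delta>\<theta> x (max 0 t)" for \<alpha> x t
  define W where "W \<alpha> x t = q \<alpha> \<bullet> \<omega> x (max 0 t)" for \<alpha> x t
  define p where "p \<alpha> x t = r \<alpha> \<bullet> \<delta>P x (max 0 t)" for \<alpha> x t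
  have sym: "transpose L = L" using L_psd by (simp add: pos_semidef_def)
  note modal = modal_dynamics[OF d_pos m_pos ratio sym u_eigen dynamics]

  have noise_meas: "(\<lambda>x. \<delta>P x t $ i) \<in> borel_measurable M" 
    and noise_square: "integrable M (\<lambda>x. (\<delta>P x t $ i)\<^sup>2)" if "0 \<le> t" for t i
  proof -
    have "(\<lambda>x. \<delta>P x t $ i) \<in> borel_measurable M \<and> integrable M (\<lambda>x. (\<delta>P x t $ i)\<^sup>2)"
    proof (cases "i \<in> N")
      case True
      \<comment> \<open>A single component is the linear combination over one index with coefficient
        1. Off the set \<open>N\<close> the noise vanishes identically, which settles the other
        case.\<close>
      have "gaussian_rv M (\<lambda>x. \<Sum>j\<in>{(i, t)}. 1 * (case j of (i, t) \<Rightarrow> \<lambda>x. \<delta>P x t $ i) x)"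
        using noise_gaussian[unfolded gaussian_family_def, rule_format, of "{(i, t)}" "\<lambda>_. 1"] True that
        by simp
      then have "gaussian_rv M (\<lambda>x. \<delta>P x t $ i)" by simp
      then show ?thesis
        using gaussian_rv_integrable_square[OF prob] by (simp add: gaussian_rv_def)
    next
      case False
      then have "\<And>x. x \<in> space M \<Longrightarrow> \<delta>P x t $ i = 0" using noise_off that by blast
      then show ?thesis by (simp cong: measurable_cong Bochner_Integration.integrable_cong)
    qed
    then show "(\<lambda>x. \<delta>P x t $ i) \<in> borel_measurable M" "integrable M (\<lambda>x. (\<delta>P x t $ i)\<^sup>2)" by auto
  qed
  note noise_prod = integrable_mult_if_squares(1)[OF noise_meas noise_meas noise_square noise_square]
  have cov: "(\<integral>x. \<delta>P x s $ i * \<delta>P x t $ j \<partial>M)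
      = (if i = j \<and> i \<in> N then (\<delta>P0 i)\<^sup>2 * exp (- \<bar>s - t\<bar> / \<tau>0) else 0)"
    if "0 \<le> s" "0 \<le> t" for s t i j
  proof (cases "i \<in> N \<and> j \<in> N")
    case True
    then show ?thesis using noise_cov[of i j s t] that by simp
  next
    case False
    then have "\<And>x. x \<in> space M \<Longrightarrow> \<delta>P x s $ i * \<delta>P x t $ j = 0"
      using noise_off that by auto
    then have "(\<integral>x. \<delta>P x s $ i * \<delta>P x t $ j \<partial>M) = (\<integral>x. 0 \<partial>M)"
      by (intro Bochner_Integration.integral_cong) auto
    then show ?thesis using False by auto
  qed

  \<comment> \<open>Noise at different nodes is uncorrelated, so this double sum collapses to its
    diagonal after averaging. The squared weights \<open>r \<alpha> $ i * r \<alpha> $ i\<close> are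
    the source of the inverse damping in the result.\<close>
  have p_expand: "p \<alpha> x s * p \<alpha> x t
      = (\<Sum>i\<in>UNIV. \<Sum>j\<in>UNIV. r \<alpha> $ i * r \<alpha> $ j * (\<delta>P x s $ i * \<delta>P x t $ j))"
    if "0 \<le> s" "0 \<le> t" for \<alpha> x s t
    using that by (simp add: p_def inner_vec_def sum_product mult_ac)
  have p_int: "integrable M (\<lambda>x. p \<alpha> x s * p \<alpha> x t)" if "0 \<le> s" "0 \<le> t" for \<alpha> s t
    unfolding p_expand[OF that] using noise_prod[OF that that]
    by (intro Bochner_Integration.integrable_sum integrable_mult_right)
  have p_cov: "(\<integral>x. p \<alpha> x s * p \<alpha> x t \<partial>M) = c \<alpha> * exp (- \<bar>s - t\<bar> / \<tau>0)"
    if "0 \<le> s" "0 \<le> t" for \<alpha> s t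
  proof -
    let ?e = "exp (- \<bar>s - t\<bar> / \<tau>0)"
    have "(\<integral>x. p \<alpha> x s * p \<alpha> x t \<partial>M)
        = (\<Sum>i\<in>UNIV. \<Sum>j\<in>UNIV. r \<alpha> $ i * r \<alpha> $ j * (\<integral>x. \<delta>P x s $ i * \<delta>P x t $ j \<partial>M))"
      unfolding p_expand[OF that] using noise_prod[OF that that]
      by (simp add: Bochner_Integration.integral_sum Bochner_Integration.integrable_sum)
    also have "\<dots> = (\<Sum>i\<in>UNIV. \<Sum>j\<in>UNIV. if i = j then
        (if i \<in> N then r \<alpha> $ i * r \<alpha> $ i * ((\<delta>P0 i)\<^sup>2 * ?e) else 0) else 0)"
      unfolding cov[OF that] by (intro sum.cong refl) auto
    also have "\<dots> = (\<Sum>i\<in>UNIV. if i \<in> N then r \<alpha> $ i * r \<alpha> $ i * ((\<delta>P0 i)\<^sup>2 * ?e) else 0)"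
      by simp
    also have "\<dots> = (\<Sum>i\<in>N. r \<alpha> $ i * r \<alpha> $ i * ((\<delta>P0 i)\<^sup>2 * ?e))"
      by (simp add: sum.If_cases)
    also have "\<dots> = (\<Sum>i\<in>N. (\<delta>P0 i)\<^sup>2 * (u \<alpha> $ i)\<^sup>2 * inverse (d $ i) * ?e)"
    proof (rule sum.cong[OF refl])
      fix i
      have "r \<alpha> $ i * r \<alpha> $ i = (u \<alpha> $ i)\<^sup>2 * inverse (d $ i)"
        using real_sqrt_mult_self[of "d $ i"] d_pos[of i]
        by (simp add: r_def power2_eq_square divide_inverse flip: inverse_mult_distrib)
      then show "r \<alpha> $ i * r \<alpha> $ i * ((\<delta>P0 i)\<^sup>2 * ?e)
          = (\<delta>P0 i)\<^sup>2 * (u \<alpha> $ i)\<^sup>2 * inverse (d $ i) * ?e" by (simp only: mult_ac)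
    qed
    finally show ?thesis by (simp add: c_def sum_distrib_right)
  qed

  \<comment> \<open>The restriction to \<open>\<alpha> \<ge> 2\<close> supplies a positive
    stiffness. The mode \<open>\<alpha> = 1\<close> has no restoring force; subtraction of the mean
    frequency has removed it from the effort.\<close>
  have osc: "noisy_oscillator M (Y \<alpha>) (W \<alpha>) (p \<alpha>) \<gamma> (lam \<alpha>) \<tau>0 (c \<alpha>)" if \<alpha>: "\<alpha> \<in> {2..CARD('n)}" for \<alpha>
  proof -
    have \<alpha>': "\<alpha> \<in> {1..CARD('n)}" using \<alpha> by auto
    let ?y = "\<lambda>x t. q \<alpha> \<bullet> \<delta>\<theta> x t" and ?w = "\<lambda>x t. q \<alpha> \<bullet> \<omega> x t" and ?p = "\<lambda>x t. r \<alpha> \<bullet> \<delta>P x t"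
    have dy: "(?y x has_real_derivative ?w x t) (at t within {0..})"
      and dw: "(?w x has_real_derivative \<gamma> * (?p x t - ?w x t - lam \<alpha> * ?y x t)) (at t within {0..})"
      if "x \<in> space M" "0 \<le> t" for x t
      using modal[OF \<alpha>' that] by (simp_all add: q_def r_def)
    have y0: "?y x 0 = 0" and w0: "?w x 0 = 0" if "x \<in> space M" for x
      using dynamics[OF that] by (simp_all add: linear_swing_solution_def)
    have wm: "(\<lambda>x. ?w x t) \<in> borel_measurable M" if "0 \<le> t" for t
      using \<omega>_random[OF that] by (intro borel_measurable_inner) auto
    note meas = oscillator_measurable[OF \<gamma>_pos y0 dy dw wm]
    show ?thesis
    proof
      show "(\<lambda>(x, t). Y \<alpha> x t) \<in> borel_measurable (M \<Otimes>\<^sub>M lborel)"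
        "(\<lambda>(x, t). W \<alpha> x t) \<in> borel_measurable (M \<Otimes>\<^sub>M lborel)"
        "(\<lambda>(x, t). p \<alpha> x t) \<in> borel_measurable (M \<Otimes>\<^sub>M lborel)"
        unfolding Y_def W_def p_def by (rule meas; assumption)+
      fix x t assume x: "x \<in> space M"
      show "Y \<alpha> x 0 = 0" "W \<alpha> x 0 = 0" using y0[OF x] w0[OF x] by (simp_all add: Y_def W_def)
      assume t: "(0::real) \<le> t"
      \<comment> \<open>A derivative within \<open>{0..}\<close> only sees nonnegative times, where
        clipping has no effect.\<close>
      show "(Y \<alpha> x has_real_derivative W \<alpha> x t) (at t within {0..})"
        by (rule has_field_derivative_transform_within[OF _ zero_less_one, of "?y x"])
           (use dy[OF x t] t in \<open>auto simp: Y_def W_def\<close>)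
      show "(W \<alpha> x has_real_derivative \<gamma> * (p \<alpha> x t - W \<alpha> x t - lam \<alpha> * Y \<alpha> x t)) (at t within {0..})"
        by (rule has_field_derivative_transform_within[OF _ zero_less_one, of "?w x"])
           (use dw[OF x t] t in \<open>auto simp: Y_def W_def p_def\<close>)
    qed (use \<gamma>_pos \<tau>0_pos lam_pos[OF \<alpha>] p_cov p_int in \<open>simp_all add: power2_eq_square\<close>)
  qed

  have effort: "control_effort d (\<omega> x) T
      = (\<Sum>\<alpha>\<in>{2..CARD('n)}. inverse T * integral {0..T} (\<lambda>t. (W \<alpha> x t)\<^sup>2))"
    if x: "x \<in> space M" for x T
  proof -
    have "integral {0..T} (\<lambda>t. (\<omega> x t - mean_frequency d (\<omega> x t)) \<bullet>
            (diag_matrix d *v (\<omega> x t - mean_frequency d (\<omega> x t))))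
        = integral {0..T} (\<lambda>t. \<Sum>\<alpha>\<in>{2..CARD('n)}. (W \<alpha> x t)\<^sup>2)"
      by (rule Henstock_Kurzweil_Integration.integral_cong)
         (use control_effort_modes[OF d_pos u_orthonormal u_1] in \<open>simp add: W_def q_def\<close>)
    \<comment> \<open>Each mode is continuous in time, so its square is integrable on
      \<open>{0..T}\<close> and the finite sum may leave the integral.\<close>
    also have "\<dots> = (\<Sum>\<alpha>\<in>{2..CARD('n)}. integral {0..T} (\<lambda>t. (W \<alpha> x t)\<^sup>2))"
    proof (rule integral_sum)
      fix \<alpha> assume "\<alpha> \<in> {2..CARD('n)}"
      from noisy_oscillator.continuous_w[OF osc[OF this] x]
      show "(\<lambda>t. (W \<alpha> x t)\<^sup>2) integrable_on {0..T}"
        by (intro integrable_continuous_real continuous_intros) (auto elim: continuous_on_subset)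
    qed simp
    finally show ?thesis by (simp add: control_effort_def sum_distrib_left)
  qed
  have mode_int: "integrable M (\<lambda>x. inverse T * integral {0..T} (\<lambda>t. (W \<alpha> x t)\<^sup>2))"
    if "\<alpha> \<in> {2..CARD('n)}" "0 < T" for \<alpha> T
    using noisy_oscillator.integrable_square_effort[OF osc[OF that(1)], of T] that(2) by simp
  show ?thesis
  proof (intro conjI allI impI)
    fix T :: real assume "0 < T"
    then show "integrable M (\<lambda>x. control_effort d (\<omega> x) T)"
      using mode_int
      by (subst Bochner_Integration.integrable_cong[OF refl effort]) (auto intro!: Bochner_Integration.integrable_sum)
  next
    have "((\<lambda>T. \<Sum>\<alpha>\<in>{2..CARD('n)}. inverse T * (\<integral>x. integral {0..T} (\<lambda>t. (W \<alpha> x t)\<^sup>2) \<partial>M))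
        \<longlongrightarrow> (\<Sum>\<alpha>\<in>{2..CARD('n)}. c \<alpha> / (lam \<alpha> * \<tau>0 + 1 + inverse \<gamma> * inverse \<tau>0))) at_top"
      by (intro tendsto_sum noisy_oscillator.mean_square_effort_limit[OF osc])
    moreover have "\<forall>\<^sub>F T in at_top.
        (\<Sum>\<alpha>\<in>{2..CARD('n)}. inverse T * (\<integral>x. integral {0..T} (\<lambda>t. (W \<alpha> x t)\<^sup>2) \<partial>M))
        = (\<integral>x. control_effort d (\<omega> x) T \<partial>M)"
    proof (rule eventually_mono[OF eventually_gt_at_top[of 0]])
      fix T :: real assume T: "0 < T"
      have "(\<integral>x. control_effort d (\<omega> x) T \<partial>M)
          = (\<integral>x. (\<Sum>\<alpha>\<in>{2..CARD('n)}. inverse T * integral {0..T} (\<lambda>t. (W \<alpha> x t)\<^sup>2)) \<partial>M)"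
        by (intro Bochner_Integration.integral_cong refl effort)
      also have "\<dots> = (\<Sum>\<alpha>\<in>{2..CARD('n)}. \<integral>x. inverse T * integral {0..T} (\<lambda>t. (W \<alpha> x t)\<^sup>2) \<partial>M)"
        using mode_int T by (intro Bochner_Integration.integral_sum)
      finally show "(\<Sum>\<alpha>\<in>{2..CARD('n)}. inverse T * (\<integral>x. integral {0..T} (\<lambda>t. (W \<alpha> x t)\<^sup>2) \<partial>M))
        = (\<integral>x. control_effort d (\<omega> x) T \<partial>M)" by simp
    qed
    ultimately show "((\<lambda>T. \<integral>x. control_effort d (\<omega> x) T \<partial>M) \<longlongrightarrow>
      (\<Sum>\<alpha>\<in>{2..CARD('n)}.
        (\<Sum>i\<in>N. (\<delta>P0 i)\<^sup>2 * (u \<alpha> $ i)\<^sup>2 * inverse (d $ i)) /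
        (lam \<alpha> * \<tau>0 + 1 + inverse \<gamma> * inverse \<tau>0))) at_top"
      unfolding c_def by (rule Lim_transform_eventually)
  qed
qed

end
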